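(* Let $\alpha_1,\alpha_2,\alpha_3$ be real numbers with $0<\alpha_1<\alpha_2$ and $\alpha_3\ge \alpha_1+\alpha_2$, and set $\beta=\left(2\left\lceil \frac{\alpha_1+\alpha_2+\alpha_3+1}{\alpha_1}\right\rceil\right)^6$ and $\gamma=\frac{12}{\alpha_1}\left\lceil \frac{\alpha_1+\alpha_2+\alpha_3+1}{\alpha_1}\right\rceil$. For every $\varepsilon$ with $0<\varepsilon<\frac{1}{\beta+(\alpha_1+\alpha_2+\alpha_3)\gamma}$ there is $n_0=n_0(\varepsilon)$ such that the following holds for every $n>n_0$. Let $G$ be a bipartite graph with bipartition $\{V_1,V_2\}$, $|V_1|=|V_2|=N$, where $N\ge (\alpha_1+\alpha_2+\alpha_3+(\beta+(\alpha_1+\alpha_2+\alpha_3)\gamma)\varepsilon)n$, such that every vertex of $V_1$ has at most $\varepsilon n$ non-neighbours in $V_2$ and every vertex of $V_2$ has at most $\varepsilon n$ non-neighbours in $V_1$. Then every red-blue-green colouring of the edges of $G$ contains a red $\lfloor \alpha_1 n\rfloor$-connected matching, or a blue $\lfloor \alpha_2 n\rfloor$-connected matching, or a green $\lfloor \alpha_3 n\rfloor$-connected matching.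
   Context: For a graph whose edges are coloured with red, blue and green, a red (resp. blue, green) $t$-connected matching is a connected component of the spanning subgraph formed by the red (resp. blue, green) edges whose maximum matching has size at least $t$. *)

theory Defs
  imports Complex_Main "Graph_Theory.Digraph_Component"
begin

text \<open>
  A finite simple graph is a \<open>pair_graph\<close>: a finite, symmetric, loop-free digraph whose arcs are
  pairs of vertices. Each undirected edge is thus a pair of opposite arcs, and is represented below
  by the two-element set of its ends.
\<close>

definition bipartition :: "'a pair_pre_digraph \<Rightarrow> 'a set \<Rightarrow> 'a set \<Rightarrow> bool" where
  "bipartition G V1 V2 \<longleftrightarrow>
     V1 \<union> V2 = pverts G \<and> V1 \<inter> V2 = {} \<and>
     parcs G \<subseteq> V1 \<times> V2 \<union> V2 \<times> V1"

definition non_neighbours :: "'a pair_pre_digraph \<Rightarrow> 'a set \<Rightarrow> 'a \<Rightarrow> 'a set" where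
  "non_neighbours G W v = {w \<in> W. (v, w) \<notin> parcs G}"

datatype colour = Red | Blue | Green

text \<open>
  An edge colouring is a function on two-element sets, so that the two arcs of an edge get the same
  colour. Its values on sets that are not edges of the graph are irrelevant.
\<close>

definition colour_subgraph ::
    "'a pair_pre_digraph \<Rightarrow> ('a set \<Rightarrow> colour) \<Rightarrow> colour \<Rightarrow> 'a pair_pre_digraph" where
  "colour_subgraph G c k =
     \<lparr>pverts = pverts G, parcs = {(u, v). (u, v) \<in> parcs G \<and> c {u, v} = k}\<rparr>"

definition edges :: "('a, 'b) pre_digraph \<Rightarrow> 'a set set" where
  "edges H = (\<lambda>a. {tail H a, head H a}) ` arcs H"

definition matching :: "('a, 'b) pre_digraph \<Rightarrow> 'a set set \<Rightarrow> bool" where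
  "matching H M \<longleftrightarrow> M \<subseteq> edges H \<and> pairwise disjnt M"

definition maximum_matching :: "('a, 'b) pre_digraph \<Rightarrow> 'a set set \<Rightarrow> bool" where
  "maximum_matching H M \<longleftrightarrow> matching H M \<and> (\<forall>M'. matching H M' \<longrightarrow> card M' \<le> card M)"

text \<open>
  In a symmetric digraph the strongly connected components, \<open>sccs\<close>, are exactly the connected
  components of the underlying graph; isolated vertices are components as well.
\<close>

definition connected_matching ::
    "'a pair_pre_digraph \<Rightarrow> ('a set \<Rightarrow> colour) \<Rightarrow> colour \<Rightarrow> nat \<Rightarrow> ('a, 'a \<times> 'a) pre_digraph \<Rightarrow> bool" where
  "connected_matching G c k t H \<longleftrightarrow>
     H \<in> pre_digraph.sccs (with_proj (colour_subgraph G c k)) \<and>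
     (\<exists>M. maximum_matching H M \<and> t \<le> card M)"

end

theory Submission
  imports Defs
begin

text \<open>
  Suppose that no component of any colour has a large matching. By Koenig's theorem the edges of each
  component of colour \<open>i\<close> are covered by at most \<open>\<alpha>\<^sub>i n\<close> vertices. Merging components whose covers are
  jointly small leaves a bounded number of classes of each colour. The type of a vertex consists of its
  three classes and its membership in their covers. After vertices of rare type have been discarded,
  any two vertices on opposite sides share a class of some colour whose cover contains one of them,
  since an edge between vertices of the same two types shows this. What remains is an exact counting
  problem: if the covers have at most \<open>p\<close>, \<open>q\<close>, \<open>r\<close> elements and \<open>p + q \<le> r\<close>, then one side has at most
  \<open>p + q + r\<close> elements.

  Two vertices in different green classes are joined in red or blue, so every union of green classes is
  either larger than \<open>r\<close> on both sides or at most \<open>p + q\<close> on both sides. If one class is large, deleting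
  its cover leaves a red-blue blow-up of a path on six vertices; otherwise the classes form three small
  groups, which gives a red-blue blow-up of a hexagon. In a red-blue complete bipartite graph with a
  side larger than \<open>p + q\<close>, the other side is covered by one red and one blue cover unless both sides
  split crosswise, and then two red and two blue covers contain that side. Adding up the covers of
  adjacent parts contradicts the sizes.
\<close>

section \<open>Two colours\<close>

text \<open>
  The functions \<open>f\<close> and \<open>g\<close> name the red and the blue class of a vertex; \<open>S\<close> and \<open>T\<close> are the unions of
  the chosen covers of all red and all blue classes.
\<close>

locale two_cover =
  fixes f :: "'v \<Rightarrow> 'c" and S :: "'v set" and p :: real
    and g :: "'v \<Rightarrow> 'e" and T :: "'v set" and q :: real
  assumes finite_S: "finite S" and finite_T: "finite T"
    and card_S: "\<And>i. real (card {v\<in>S. f v = i}) \<le> p"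
    and card_T: "\<And>k. real (card {v\<in>T. g v = k}) \<le> q"
begin

text \<open>A complete bipartite graph in red and blue, recorded without its colouring: an edge of a
  colour puts its ends into one class of that colour and one end into the cover, and only this is
  kept.\<close>

definition joined :: "'v set \<Rightarrow> 'v set \<Rightarrow> bool" where
  "joined A Z \<longleftrightarrow>
     (\<forall>x\<in>A. \<forall>z\<in>Z. f x = f z \<and> (x \<in> S \<or> z \<in> S) \<or> g x = g z \<and> (x \<in> T \<or> z \<in> T))"

text \<open>
  The exceptional colouring of a complete bipartite graph: both sides split in two halves, red joins
  each half to its partner and blue joins it to the other half.
\<close>

definition cross :: "'v set \<Rightarrow> 'v set \<Rightarrow> bool" where
  "cross A Z \<longleftrightarrow> (\<exists>i j k l. i \<noteq> j \<and> k \<noteq> l \<and>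
     (\<lambda>v. (f v, g v)) ` A = {(i, l), (j, k)} \<and> (\<lambda>v. (f v, g v)) ` Z = {(i, k), (j, l)})"

section \<open>Covered sets and joined pairs\<close>

lemma swap: "two_cover g T q f S p"
  by unfold_locales (fact finite_T finite_S card_T card_S)+

lemma swap_joined: "two_cover.joined g T f S A Z \<longleftrightarrow> joined A Z"
  unfolding two_cover.joined_def[OF swap] joined_def by blast

lemma joined_commute: "joined A Z \<longleftrightarrow> joined Z A"
  unfolding joined_def by metis

lemma joined_Un: "joined A (Y \<union> Z) \<longleftrightarrow> joined A Y \<and> joined A Z"
  unfolding joined_def by blast

lemma bounds_nonneg: "0 \<le> p" "0 \<le> q"
  using card_S[of undefined] card_T[of undefined] by linarith+

lemma card_covered_le:
  assumes A: "A \<subseteq> S \<union> T" and I: "f ` A \<subseteq> I" "finite I" "card I \<le> m"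
    and J: "g ` A \<subseteq> J" "finite J" "card J \<le> n"
  shows "real (card A) \<le> m * p + n * q"
proof -
  let ?F = "\<Union>i\<in>I. {v\<in>S. f v = i}" and ?G = "\<Union>k\<in>J. {v\<in>T. g v = k}"
  have "A \<subseteq> ?F \<union> ?G" 
  proof
    fix v assume "v \<in> A"
    then have "f v \<in> I" "g v \<in> J" "v \<in> S \<or> v \<in> T" using A I(1) J(1) by auto
    then show "v \<in> ?F \<union> ?G" by blast
  qed
  moreover have fin: "finite ?F" "finite ?G" using I(2) J(2) finite_S finite_T by auto
  ultimately have "card A \<le> card ?F + card ?G"
    by (meson card_Un_le card_mono finite_UnI le_trans)
  moreover have "card ?F \<le> (\<Sum>i\<in>I. card {v\<in>S. f v = i})"
    by (rule card_UN_le[OF I(2)])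
  moreover have "card ?G \<le> (\<Sum>k\<in>J. card {v\<in>T. g v = k})"
    by (rule card_UN_le[OF J(2)])
  ultimately have "real (card A) \<le>
      (\<Sum>i\<in>I. real (card {v\<in>S. f v = i})) + (\<Sum>k\<in>J. real (card {v\<in>T. g v = k}))"
    by (simp flip: of_nat_sum)
  also have "\<dots> \<le> (\<Sum>i\<in>I. p) + (\<Sum>k\<in>J. q)"
    by (intro add_mono sum_mono card_S card_T)
  also have "\<dots> = card I * p + card J * q" by simp
  also have "\<dots> \<le> m * p + n * q"
    using I(3) J(3) bounds_nonneg by (intro add_mono mult_right_mono) auto
  finally show ?thesis .
qed

lemma card_one_one_le:
  assumes "A \<subseteq> {v\<in>S. f v = i} \<union> {v\<in>T. g v = k}"
  shows "real (card A) \<le> p + q"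
proof -
  have "card A \<le> card {v\<in>S. f v = i} + card {v\<in>T. g v = k}"
    using finite_S finite_T
    by (intro order_trans[OF card_mono[OF _ assms] card_Un_le]) auto
  then show ?thesis using card_S[of i] card_T[of k] by linarith
qed

text \<open>A vertex outside both covers forces the whole other side into the covers of its own red
  and blue class, which have at most \<open>p + q\<close> vertices together.\<close>

lemma joined_covered:
  assumes "joined A Z" "p + q < card Z"
  shows "A \<subseteq> S \<union> T"
proof (rule ccontr)
  assume "\<not> A \<subseteq> S \<union> T"
  then obtain x where "x \<in> A" "x \<notin> S" "x \<notin> T" by auto
  then have "Z \<subseteq> {v\<in>S. f v = f x} \<union> {v\<in>T. g v = g x}"
    using assms(1) unfolding joined_def by fastforce
  from card_one_one_le[OF this] show False using assms(2) by linarith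
qed

text \<open>Vertices on opposite sides agree in a coordinate of \<open>(f v, g v)\<close>. If both
  coordinates vary on \<open>Z\<close>, two vertices of \<open>Z\<close> differ in both, and only
  two pairs remain possible on \<open>A\<close>. If both occur, they in turn leave only two pairs on
  \<open>Z\<close>, which is the crossing pattern.\<close>

lemma joined_cases:
  assumes "joined A Z" "A \<noteq> {}" "Z \<noteq> {}"
  obtains (first) i where "f ` (A \<union> Z) = {i}"
    | (second) k where "g ` (A \<union> Z) = {k}"
    | (left) i k where "(\<lambda>v. (f v, g v)) ` A = {(i, k)}"
    | (right) i k where "(\<lambda>v. (f v, g v)) ` Z = {(i, k)}"
    | (cross) "cross A Z"
proof -
  have share: "f x = f z \<or> g x = g z" if "x \<in> A" "z \<in> Z" for x z
    using assms(1) that unfolding joined_def by blast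
  obtain x0 z0 where x0: "x0 \<in> A" and z0: "z0 \<in> Z" using assms(2,3) by blast
  obtain i0 k0 where ik: "f z0 = i0" "g z0 = k0" by blast
  consider (a) "\<forall>z\<in>Z. f z = i0" "\<forall>z\<in>Z. g z = k0"
    | (b) z1 where "\<forall>z\<in>Z. f z = i0" "z1 \<in> Z" "g z1 \<noteq> k0"
    | (c) z1 where "\<forall>z\<in>Z. g z = k0" "z1 \<in> Z" "f z1 \<noteq> i0"
    | (d) z1 z2 where "z1 \<in> Z" "f z1 \<noteq> i0" "z2 \<in> Z" "g z2 \<noteq> k0"
    by (cases "\<forall>z\<in>Z. f z = i0"; cases "\<forall>z\<in>Z. g z = k0"; blast)
  then show thesis
  proof cases
    case a
    then have "(\<lambda>v. (f v, g v)) ` Z = {(i0, k0)}" using z0 by force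
    then show ?thesis by (rule right)
  next
    case b
    have "f x = i0" if "x \<in> A" for x using share[OF that b(2)] share[OF that z0] ik b by auto
    then have "f ` (A \<union> Z) = {i0}" using b(1) z0 ik by auto
    then show ?thesis by (rule first)
  next
    case c
    have "g x = k0" if "x \<in> A" for x using share[OF that c(2)] share[OF that z0] ik c by auto
    then have "g ` (A \<union> Z) = {k0}" using c(1) z0 ik by auto
    then show ?thesis by (rule second)
  next
    case d
    obtain z z' where z: "z \<in> Z" "z' \<in> Z" "f z \<noteq> f z'" "g z \<noteq> g z'"
    proof (cases "g z1 = k0")
      case False then show ?thesis using that[of z1 z0] d z0 ik by simp
    next
      case True
      show ?thesis
      proof (cases "f z2 = i0")
        case False then show ?thesis using that[of z2 z0] d z0 ik by simp
      next
        \<comment> \<open>Here \<open>z1\<close> has the blue class of \<open>z0\<close> and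
          \<open>z2\<close> its red class, so \<open>z1\<close> and \<open>z2\<close> differ in both
          coordinates.\<close>
        case 2: True
        show ?thesis using that[of z1 z2] True 2 d by simp
      qed
    qed
    obtain i j k l where v: "f z = i" "f z' = j" "g z = k" "g z' = l" by blast
    have ne: "i \<noteq> j" "k \<noteq> l" using z v by auto
    have A: "(f v, g v) \<in> {(i, l), (j, k)}" if "v \<in> A" for v
      using share[OF that z(1)] share[OF that z(2)] v ne by auto
    show ?thesis
    proof (cases "(i, l) \<in> (\<lambda>v. (f v, g v)) ` A \<and> (j, k) \<in> (\<lambda>v. (f v, g v)) ` A")
      case False
      then have "(\<lambda>v. (f v, g v)) ` A = {(i, l)} \<or> (\<lambda>v. (f v, g v)) ` A = {(j, k)}"
        using A x0 by blast
      then show ?thesis using left by blast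
    next
      case True
      then obtain x y where xy: "x \<in> A" "y \<in> A" "f x = i" "g x = l" "f y = j" "g y = k" by auto
      have Z: "(f w, g w) \<in> {(i, k), (j, l)}" if "w \<in> Z" for w
        using share[OF xy(1) that] share[OF xy(2) that] xy ne by auto
      have "(i, k) \<in> (\<lambda>v. (f v, g v)) ` Z" "(j, l) \<in> (\<lambda>v. (f v, g v)) ` Z"
        using z(1,2) v by (auto intro: rev_image_eqI)
      then have "(\<lambda>v. (f v, g v)) ` Z = {(i, k), (j, l)}" using Z by blast
      moreover have "(\<lambda>v. (f v, g v)) ` A = {(i, l), (j, k)}" using True A by blast
      ultimately have "cross A Z" unfolding cross_def using ne by blast
      then show ?thesis by (rule cross)
    qed
  qed
qed

text \<open>With red constant, vertices outside \<open>S\<close> on opposite sides are linked in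
  blue. If \<open>A\<close> has such a vertex, its blue class contains \<open>Z - S\<close>; as
  \<open>Z\<close> is too large to be covered, some \<open>z\<close> lies outside both covers and
  forces \<open>A - S\<close> into the blue cover of its class.\<close>

lemma first_const:
  assumes "joined A Z" "p + q < card Z" "f ` (A \<union> Z) = {i}"
  shows "\<exists>k. A \<subseteq> {v\<in>S. f v = i} \<union> {v\<in>T. g v = k}"
proof (cases "A \<subseteq> S")
  case True
  have "f v = i" if "v \<in> A" for v using assms(3) that by blast
  then show ?thesis using True by blast
next
  case False
  then obtain x where x: "x \<in> A" "x \<notin> S" by blast
  have fi: "f v = i" if "v \<in> A \<union> Z" for v using assms(3) that by blast
  have link: "g y = g z \<and> (y \<in> T \<or> z \<in> T)" if "y \<in> A" "z \<in> Z" "y \<notin> S" "z \<notin> S" for y z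
    using assms(1) that unfolding joined_def by blast
  have "\<not> Z \<subseteq> S \<union> T"
  proof
    assume "Z \<subseteq> S \<union> T"
    moreover have "g z = g x" if "z \<in> Z" "z \<notin> S" for z using link[OF x(1) that(1) x(2) that(2)] by simp
    ultimately have "Z \<subseteq> {v\<in>S. f v = i} \<union> {v\<in>T. g v = g x}" using fi by blast
    from card_one_one_le[OF this] show False using assms(2) by linarith
  qed
  then obtain z where z: "z \<in> Z" "z \<notin> S" "z \<notin> T" by blast
  have "A \<subseteq> {v\<in>S. f v = i} \<union> {v\<in>T. g v = g z}"
  proof
    fix y assume y: "y \<in> A"
    show "y \<in> {v\<in>S. f v = i} \<union> {v\<in>T. g v = g z}"
    proof (cases "y \<in> S")
      case True then show ?thesis using fi y by simp
    next
      case False then show ?thesis using link[OF y z(1) False z(2)] z(3) by simp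
    qed
  qed
  then show ?thesis by blast
qed

text \<open>Constant classes on \<open>A\<close> suffice since \<open>A\<close> is covered. With
  constant classes on \<open>Z\<close>, the size of \<open>Z\<close> yields a vertex outside both
  covers, so the covers of its two classes contain \<open>A\<close>. One common class is the case of
  \<open>first_const\<close>, up to exchanging colours.\<close>

lemma joined_one_one_or_cross:
  assumes "joined A Z" "p + q < card Z"
  shows "(\<exists>i k. A \<subseteq> {v\<in>S. f v = i} \<union> {v\<in>T. g v = k}) \<or> cross A Z"
proof (cases "A = {}")
  case True then show ?thesis by auto
next
  case False
  have cov: "A \<subseteq> S \<union> T" by (rule joined_covered[OF assms])
  have "Z \<noteq> {}" using assms(2) bounds_nonneg by auto
  with assms(1) False show ?thesis
  proof (cases rule: joined_cases)
    case (first i)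
    then show ?thesis using first_const[OF assms] by blast
  next
    case (second k)
    then show ?thesis
      using two_cover.first_const[OF swap, of A Z k] assms
      by (simp add: swap_joined add.commute[of q p] Un_commute[of "{v \<in> T. g v = k}"]) blast
  next
    case (left i k)
    then have "A \<subseteq> {v\<in>S. f v = i} \<union> {v\<in>T. g v = k}" using cov by auto
    then show ?thesis by blast
  next
    case (right i k)
    then have ik: "f z = i" "g z = k" if "z \<in> Z" for z using that by auto
    have "\<not> Z \<subseteq> S \<union> T"
    proof
      assume "Z \<subseteq> S \<union> T"
      then have "Z \<subseteq> {v\<in>S. f v = i} \<union> {v\<in>T. g v = k}" using ik by blast
      from card_one_one_le[OF this] show False using assms(2) by linarith
    qed
    then obtain z where z: "z \<in> Z" "z \<notin> S" "z \<notin> T" by blast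
    have "A \<subseteq> {v\<in>S. f v = i} \<union> {v\<in>T. g v = k}"
    proof
      fix x assume "x \<in> A"
      then have "f x = f z \<and> x \<in> S \<or> g x = g z \<and> x \<in> T"
        using assms(1) z unfolding joined_def by blast
      then show "x \<in> {v\<in>S. f v = i} \<union> {v\<in>T. g v = k}" using ik[OF z(1)] by auto
    qed
    then show ?thesis by blast
  qed auto
qed

section \<open>Sizes with and without the crossing pattern\<close>

lemma cross_imageE:
  assumes "cross A Z"
  obtains i j k l where "i \<noteq> j" "k \<noteq> l"
    "(\<lambda>v. (f v, g v)) ` A = {(i, l), (j, k)}" "(\<lambda>v. (f v, g v)) ` Z = {(i, k), (j, l)}"
  using assms unfolding cross_def by blast

lemma cross_ranges:
  assumes "cross A Z"
  obtains i j k l where "f ` (A \<union> Z) = {i, j}" "g ` (A \<union> Z) = {k, l}" "i \<noteq> j" "k \<noteq> l"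
    "f ` A = {i, j}" "g ` A = {k, l}" "f ` Z = {i, j}" "g ` Z = {k, l}"
proof -
  obtain i j k l where *: "i \<noteq> j" "k \<noteq> l"
    "(\<lambda>v. (f v, g v)) ` A = {(i, l), (j, k)}" "(\<lambda>v. (f v, g v)) ` Z = {(i, k), (j, l)}"
    using cross_imageE[OF assms] .
  have "fst ` (\<lambda>v. (f v, g v)) ` A = {i, j}" "snd ` (\<lambda>v. (f v, g v)) ` A = {l, k}"
    "fst ` (\<lambda>v. (f v, g v)) ` Z = {i, j}" "snd ` (\<lambda>v. (f v, g v)) ` Z = {k, l}"
    unfolding * by auto
  then have "f ` A = {i, j}" "g ` A = {k, l}" "f ` Z = {i, j}" "g ` Z = {k, l}"
    by (auto simp: image_image)
  then show thesis using that[of i j k l] *(1,2) by (simp add: image_Un)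
qed

lemma cross_card_le:
  assumes "cross A Z" "A \<subseteq> S \<union> T" "Z \<subseteq> S \<union> T"
  shows "real (card (A \<union> Z)) \<le> 2 * (p + q)"
proof -
  obtain i j k l where *: "f ` (A \<union> Z) = {i, j}" "g ` (A \<union> Z) = {k, l}"
    using cross_ranges[OF assms(1)] by metis
  have "real (card (A \<union> Z)) \<le> real 2 * p + real 2 * q"
    by (rule card_covered_le[of _ "{i, j}" _ "{k, l}"]) (use * assms(2,3) in \<open>auto simp: card_insert_if\<close>)
  then show ?thesis by simp
qed

text \<open>If both sides were large, both would be covered. Then one red and one blue cover contain
  \<open>A\<close>, or the sides cross and together have at most \<open>2 * (p + q)\<close>
  vertices; either way a side is small.\<close>

lemma joined_card_le:
  assumes "joined A Z" "finite A" "finite Z" "A \<inter> Z = {}"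
  shows "card A \<le> p + q \<or> card Z \<le> p + q"
proof (rule ccontr)
  assume "\<not> ?thesis"
  then have big: "p + q < card A" "p + q < card Z" by auto
  have cov: "A \<subseteq> S \<union> T" "Z \<subseteq> S \<union> T"
    using joined_covered assms(1) big joined_commute by blast+
  from joined_one_one_or_cross[OF assms(1) big(2)] show False
  proof
    assume "\<exists>i k. A \<subseteq> {v\<in>S. f v = i} \<union> {v\<in>T. g v = k}"
    then have "card A \<le> p + q" using card_one_one_le by blast
    then show False using big(1) by linarith
  next
    assume "cross A Z"
    from cross_card_le[OF this cov] show False
      using card_Un_disjoint[OF assms(2-4)] big by simp
  qed
qed

lemma first_const_covered:
  assumes "joined A Z" "p + q < card Z" "f ` (A \<union> Z) = {i}" "Z \<subseteq> S \<union> T"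
  shows "A \<subseteq> {v\<in>S. f v = i}"
proof (rule ccontr)
  assume neg: "\<not> ?thesis"
  have fi: "f v = i" if "v \<in> A \<union> Z" for v using assms(3) that by blast
  obtain x where x: "x \<in> A" "x \<notin> S" using neg fi by blast
  have "g z = g x" if "z \<in> Z" "z \<notin> S" for z
    using assms(1) that x unfolding joined_def by metis
  then have "Z \<subseteq> {v\<in>S. f v = i} \<union> {v\<in>T. g v = g x}" using fi assms(4) by blast
  from card_one_one_le[OF this] show False using assms(2) by linarith
qed

lemma not_cross_cases:
  assumes "joined A Z" "p + q < card Z" "Z \<subseteq> S \<union> T" "\<not> cross A Z" "A \<noteq> {}"
  obtains (first) i where "A \<subseteq> {v\<in>S. f v = i}" "f ` Z = {i}"
    | (second) k where "A \<subseteq> {v\<in>T. g v = k}" "g ` Z = {k}"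
    | (const) i k where "(\<lambda>v. (f v, g v)) ` A = {(i, k)}"
proof -
  have Z: "Z \<noteq> {}" using assms(2) bounds_nonneg by auto
  from assms(1) assms(5) Z show thesis
  proof (cases rule: joined_cases)
    case (first i)
    then have "f ` Z = {i}" using Z by auto
    then show ?thesis using that(1) first_const_covered[OF assms(1,2) first assms(3)] by blast
  next
    case (second k)
    then have gZ: "g ` Z = {k}" using Z by auto
    have "A \<subseteq> {v\<in>T. g v = k}"
      by (rule two_cover.first_const_covered[OF swap, of _ Z])
        (use assms second in \<open>auto simp: swap_joined\<close>)
    then show ?thesis using that(2) gZ by blast
  next
    case (left i k)
    then show ?thesis using that(3) by blast
  next
    case (right i k)
    then have "Z \<subseteq> {v\<in>S. f v = i} \<union> {v\<in>T. g v = k}" using assms(3) by auto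
    from card_one_one_le[OF this] show ?thesis using assms(2) by linarith
  next
    case cross
    then show ?thesis using assms(4) by blast
  qed
qed

text \<open>By \<open>not_cross_cases\<close>, each of \<open>A\<close> and \<open>B\<close> either
  lies in one cover whose class contains the other set, or has constant classes. Every combination
  leaves one red and one blue cover that contain both sets.\<close>

lemma not_cross_pair:
  assumes A: "joined A Z" "p + q < card Z" "Z \<subseteq> S \<union> T" "\<not> cross A Z"
    and B: "joined B Y" "p + q < card Y" "Y \<subseteq> S \<union> T" "\<not> cross B Y"
    and sub: "B \<subseteq> Z" "A \<subseteq> Y" and ne: "A \<noteq> {}" "B \<noteq> {}"
  shows "card (A \<union> B) \<le> p + q"
proof -
  have cov: "A \<subseteq> S \<union> T" "B \<subseteq> S \<union> T" using A(3) B(3) sub by auto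
  obtain a b where ab: "a \<in> A" "b \<in> B" using ne by blast
  consider (A1) i where "\<forall>x\<in>A. x \<in> S \<and> f x = i" "\<forall>y\<in>B. f y = i"
    | (A2) k where "\<forall>x\<in>A. x \<in> T \<and> g x = k" "\<forall>y\<in>B. g y = k"
    | (A3) i k where "\<forall>x\<in>A. f x = i \<and> g x = k"
    using A ne(1)
  proof (cases rule: not_cross_cases)
    case (first i)
    then show ?thesis using A1[of i] sub(1) by blast
  next
    case (second k)
    then show ?thesis using A2[of k] sub(1) by blast
  next
    case (const i k)
    then show ?thesis using A3[of i k] by blast
  qed
  note A_cases = this
  consider (B1) i where "\<forall>y\<in>B. y \<in> S \<and> f y = i" "\<forall>x\<in>A. f x = i"
    | (B2) k where "\<forall>y\<in>B. y \<in> T \<and> g y = k" "\<forall>x\<in>A. g x = k"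
    | (B3) i k where "\<forall>y\<in>B. f y = i \<and> g y = k"
    using B ne(2)
  proof (cases rule: not_cross_cases)
    case (first i)
    then show ?thesis using B1[of i] sub(2) by blast
  next
    case (second k)
    then show ?thesis using B2[of k] sub(2) by blast
  next
    case (const i k)
    then show ?thesis using B3[of i k] by blast
  qed
  note B_cases = this
  have "\<exists>i k. \<forall>v\<in>A \<union> B. v \<in> S \<and> f v = i \<or> v \<in> T \<and> g v = k"
  proof (cases rule: A_cases)
    case A1: (A1 i)
    show ?thesis
    proof (cases rule: B_cases)
      case (B1 j)
      then show ?thesis using A1 ab by (intro exI[of _ i]) auto
    next
      case (B2 k)
      then show ?thesis using A1 by (intro exI[of _ i] exI[of _ k]) auto
    next
      case (B3 j k)
      then show ?thesis using A1 cov by (intro exI[of _ i] exI[of _ k]) auto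
    qed
  next
    case A2: (A2 k)
    show ?thesis
    proof (cases rule: B_cases)
      case (B1 j)
      then show ?thesis using A2 by (intro exI[of _ j] exI[of _ k]) auto
    next
      case (B2 l)
      \<comment> \<open>A vertex of \<open>B\<close> shows \<open>k = l\<close>, so one blue cover
        contains both sets and the red class may be arbitrary.\<close>
      then show ?thesis using A2 ab by (intro exI[of _ undefined] exI[of _ k]) auto
    next
      case (B3 j l)
      then show ?thesis using A2 cov by (intro exI[of _ j] exI[of _ k]) auto
    qed
  next
    case A3: (A3 i k)
    show ?thesis
    proof (cases rule: B_cases)
      case (B1 j)
      then show ?thesis using A3 cov by (intro exI[of _ j] exI[of _ k]) auto
    next
      case (B2 l)
      then show ?thesis using A3 cov by (intro exI[of _ i] exI[of _ l]) auto
    next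
      case B3: (B3 j l)
      have AB: "(i = j \<and> (x \<in> S \<or> y \<in> S)) \<or> (k = l \<and> (x \<in> T \<or> y \<in> T))" if "x \<in> A" "y \<in> B" for x y
      proof -
        have "f x = f y \<and> (x \<in> S \<or> y \<in> S) \<or> g x = g y \<and> (x \<in> T \<or> y \<in> T)"
          using A(1) sub(1) that unfolding joined_def by blast
        then show ?thesis using A3 B3 that by simp
      qed
      consider "i = j" "k = l" | "i = j" "k \<noteq> l" | "i \<noteq> j" "k = l" using AB[OF ab] by blast
      then show ?thesis
      proof cases
        case 1
        then show ?thesis using A3 B3 cov by (intro exI[of _ i] exI[of _ k]) auto
      next
        case 2
        \<comment> \<open>All pairs are linked in red only, so one side lies in \<open>S\<close>
          entirely. The other side, being covered, needs the same red class and its own blue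
          class.\<close>
        then have "A \<subseteq> S \<or> B \<subseteq> S" using AB by blast
        then show ?thesis
        proof
          assume "A \<subseteq> S"
          then show ?thesis using 2 A3 B3 cov by (intro exI[of _ i] exI[of _ l]) auto
        next
          assume "B \<subseteq> S"
          then show ?thesis using 2 A3 B3 cov by (intro exI[of _ i] exI[of _ k]) auto
        qed
      next
        case 3
        then have "A \<subseteq> T \<or> B \<subseteq> T" using AB by blast
        then show ?thesis
        proof
          assume "A \<subseteq> T"
          then show ?thesis using 3 A3 B3 cov by (intro exI[of _ j] exI[of _ k]) auto
        next
          assume "B \<subseteq> T"
          then show ?thesis using 3 A3 B3 cov by (intro exI[of _ i] exI[of _ k]) auto
        qed
      qed
    qed
  qed
  then obtain i k where "\<forall>v\<in>A \<union> B. v \<in> S \<and> f v = i \<or> v \<in> T \<and> g v = k" by blast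
  then have "A \<union> B \<subseteq> {v\<in>S. f v = i} \<union> {v\<in>T. g v = k}" by blast
  then show ?thesis by (rule card_one_one_le)
qed

text \<open>The crossing of \<open>A\<close> with \<open>B \<union> W\<close> uses two classes of
  each colour. Either one cover of each colour contains \<open>U\<close>, or \<open>U\<close>
  crosses with \<open>Q \<union> B\<close>; a common vertex in \<open>B\<close> then ties the two
  patterns together, so that \<open>U\<close> adds at most one class of each colour.\<close>

lemma cross_path_card_le:
  assumes "cross A (B \<union> W)" "joined U (Q \<union> B)" "p + q < card (Q \<union> B)" "B \<noteq> {}"
    and cov: "A \<union> B \<union> U \<union> W \<subseteq> S \<union> T"
  shows "real (card (A \<union> B \<union> U \<union> W)) \<le> 3 * (p + q)"
proof -
  obtain i j k l where ij: "i \<noteq> j" "k \<noteq> l" and A: "(\<lambda>v. (f v, g v)) ` A = {(i, l), (j, k)}"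
    and BW: "(\<lambda>v. (f v, g v)) ` (B \<union> W) = {(i, k), (j, l)}"
    using cross_imageE[OF assms(1)] .
  have three: "card (insert x {i, j}) \<le> 3" "card (insert y {k, l}) \<le> 3" for x y
    by (auto simp: card_insert_if)
  have *: ?thesis if "f ` U \<subseteq> insert x {i, j}" "g ` U \<subseteq> insert y {k, l}" for x y
  proof -
    have fA: "f v = i \<and> g v = l \<or> f v = j \<and> g v = k" if "v \<in> A" for v
      using imageI[OF that, of "\<lambda>v. (f v, g v)"] unfolding A by simp
    have fB: "f v = i \<and> g v = k \<or> f v = j \<and> g v = l" if "v \<in> B \<union> W" for v
      using imageI[OF that, of "\<lambda>v. (f v, g v)"] unfolding BW by simp
    have "real (card (A \<union> B \<union> U \<union> W)) \<le> real 3 * p + real 3 * q"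
    proof (rule card_covered_le[OF cov _ _ three(1)[of x] _ _ three(2)[of y]])
      show "f ` (A \<union> B \<union> U \<union> W) \<subseteq> insert x {i, j}" "g ` (A \<union> B \<union> U \<union> W) \<subseteq> insert y {k, l}"
        using fA fB that by auto
    qed auto
    then show ?thesis by simp
  qed
  from joined_one_one_or_cross[OF assms(2,3)] show ?thesis
  proof
    assume "\<exists>x y. U \<subseteq> {v\<in>S. f v = x} \<union> {v\<in>T. g v = y}"
    then obtain x y where U: "U \<subseteq> {v\<in>S. f v = x} \<union> {v\<in>T. g v = y}" by blast
    have "A \<union> B \<union> U \<union> W = (A \<union> (B \<union> W)) \<union> U" by blast
    then have "real (card (A \<union> B \<union> U \<union> W)) \<le> real (card (A \<union> (B \<union> W))) + real (card U)"
      by (metis card_Un_le of_nat_add of_nat_mono)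
    moreover have "real (card (A \<union> (B \<union> W))) \<le> 2 * (p + q)"
      using cross_card_le assms(1) cov by blast
    ultimately show ?thesis using card_one_one_le[OF U] by argo
  next
    assume "cross U (Q \<union> B)"
    then obtain i' j' k' l' where ij': "i' \<noteq> j'" "k' \<noteq> l'"
      and U: "(\<lambda>v. (f v, g v)) ` U = {(i', l'), (j', k')}"
      and QB: "(\<lambda>v. (f v, g v)) ` (Q \<union> B) = {(i', k'), (j', l')}"
      by (rule cross_imageE)
    obtain y where "y \<in> B" using assms(4) by blast
    then have y: "y \<in> B \<union> W" "y \<in> Q \<union> B" by simp_all
    then have "(f y, g y) \<in> {(i, k), (j, l)}" "(f y, g y) \<in> {(i', k'), (j', l')}"
      using imageI[OF y(1), of "\<lambda>v. (f v, g v)"] imageI[OF y(2), of "\<lambda>v. (f v, g v)"]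
      unfolding BW QB by simp_all
    then have "\<exists>x z. {i', j'} \<subseteq> insert x {i, j} \<and> {k', l'} \<subseteq> insert z {k, l}" by auto
    then obtain x z where xz: "{i', j'} \<subseteq> insert x {i, j}" "{k', l'} \<subseteq> insert z {k, l}" by blast
    have "f ` U = fst ` {(i', l'), (j', k')}" "g ` U = snd ` {(i', l'), (j', k')}"
      unfolding U[symmetric] by (auto simp: image_image)
    then have "f ` U = {i', j'}" "g ` U = {l', k'}" by auto
    then show ?thesis using *[of x z] xz by auto
  qed
qed

text \<open>
  The six sets are consecutive along the path \<open>Q - U - B - A - W - P\<close>.
\<close>

lemma no_path:
  assumes joined: "joined A (B \<union> W)" "joined B (A \<union> U)" "joined U (Q \<union> B)" "joined W (P \<union> A)"
    and large: "p + q < card (B \<union> W)" "p + q < card (A \<union> U)" "p + q < card (Q \<union> B)"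
      "p + q < card (P \<union> A)" "p + q < card (A \<union> B)" "3 * (p + q) < card (A \<union> B \<union> U \<union> W)"
    and fin: "finite A" "finite B" "finite U" "finite W"
    and disj: "A \<inter> (B \<union> W) = {}" "B \<inter> (A \<union> U) = {}"
  shows False
proof -
  have cov: "A \<subseteq> S \<union> T" "B \<subseteq> S \<union> T" "U \<subseteq> S \<union> T" "W \<subseteq> S \<union> T"
    using joined large by (auto dest!: joined_covered)
  \<comment> \<open>The sets joined to \<open>A\<close> and \<open>B\<close> are large, so
    \<open>A\<close> and \<open>B\<close> are small; since their union is large, neither is
    empty.\<close>
  have "card A \<le> p + q" "card B \<le> p + q"
    using joined_card_le[OF joined(1) _ _ disj(1)] joined_card_le[OF joined(2) _ _ disj(2)] large fin
    by auto
  then have ne: "A \<noteq> {}" "B \<noteq> {}" using large(5) by auto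
  \<comment> \<open>A crossing at \<open>A\<close> or at \<open>B\<close> would bound the four inner
    sets by \<open>3 * (p + q)\<close>.\<close>
  have "\<not> cross A (B \<union> W)"
    using cross_path_card_le[OF _ joined(3) large(3) ne(2), of A W] cov large(6) by auto
  moreover have "\<not> cross B (A \<union> U)"
  proof
    assume "cross B (A \<union> U)"
    from cross_path_card_le[OF this joined(4) large(4) ne(1)]
    have "real (card (B \<union> A \<union> W \<union> U)) \<le> 3 * (p + q)" using cov by blast
    moreover have "B \<union> A \<union> W \<union> U = A \<union> B \<union> U \<union> W" by blast
    ultimately show False using large(6) by simp
  qed
  ultimately have "card (A \<union> B) \<le> p + q"
    using cov by (intro not_cross_pair[OF joined(1) large(1) _ _ joined(2) large(2)] ne) auto
  then show False using large(5) by linarith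
qed

section \<open>Red-blue blow-ups of a hexagon\<close>

definition hexagon :: "(nat \<Rightarrow> 'v set) \<Rightarrow> (nat \<Rightarrow> 'v set) \<Rightarrow> bool" where
  "hexagon X Y \<longleftrightarrow>
     (\<forall>i<3. \<forall>j<3. i \<noteq> j \<longrightarrow> joined (X i) (Y j) \<and> joined (Y i) (X j)) \<and>
     (\<forall>i<3. \<forall>j<3. i \<noteq> j \<longrightarrow> X i \<inter> X j = {} \<and> Y i \<inter> Y j = {}) \<and>
     (\<forall>i<3. \<forall>j<3. X i \<inter> Y j = {} \<and> Y i \<inter> X j = {}) \<and>
     (\<forall>i<3. finite (X i) \<and> finite (Y i) \<and> card (X i) \<le> p + q \<and> card (Y i) \<le> p + q) \<and>
     2 * (p + q) < card (X 0) + card (X 1) + card (X 2) \<and>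
     2 * (p + q) < card (Y 0) + card (Y 1) + card (Y 2)"

lemma hexagon_swap: "hexagon X Y \<Longrightarrow> hexagon Y X"
  unfolding hexagon_def by (elim conjE) (intro conjI allI impI; simp)

text \<open>The three indices in some order. On the hexagon \<open>X i\<close> is adjacent to
  \<open>Y j\<close> and \<open>Y k\<close> and opposite to \<open>Y i\<close>; facts stated for
  every order cover all parts by symmetry.\<close>

definition distinct_indices :: "nat \<Rightarrow> nat \<Rightarrow> nat \<Rightarrow> bool" where
  "distinct_indices i j k \<longleftrightarrow> i < 3 \<and> j < 3 \<and> k < 3 \<and> i \<noteq> j \<and> i \<noteq> k \<and> j \<noteq> k"

lemma distinct_indices_rot:
  assumes "distinct_indices i j k"
  shows "distinct_indices j i k" "distinct_indices k i j" "distinct_indices i k j"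
    "distinct_indices k j i" "distinct_indices j k i"
  using assms unfolding distinct_indices_def by simp_all

lemma distinct_indices_sum:
  fixes h :: "nat \<Rightarrow> nat"
  assumes "distinct_indices i j k"
  shows "h i + h j + h k = h 0 + h 1 + h 2"
proof -
  have "i = 0 \<or> i = 1 \<or> i = 2" "j = 0 \<or> j = 1 \<or> j = 2" "k = 0 \<or> k = 1 \<or> k = 2"
    using assms unfolding distinct_indices_def by linarith+
  then show ?thesis using assms unfolding distinct_indices_def by (elim disjE) simp_all
qed

lemma hexagonD:
  assumes hex: "hexagon X Y" and ijk: "distinct_indices i j k"
  shows "joined (X i) (Y j \<union> Y k)" "p + q < card (Y j \<union> Y k)" "X i \<subseteq> S \<union> T"
    "2 * (p + q) < card (X i) + card (X j) + card (X k)"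
    "card (X i) \<le> p + q" "finite (X i)" "X i \<inter> X j = {}" "X i \<inter> Y i = {}" "X i \<inter> Y j = {}"
proof -
  note ne = ijk[unfolded distinct_indices_def]
  show J: "joined (X i) (Y j \<union> Y k)"
    using hex ne unfolding hexagon_def joined_Un by simp
  show "card (X i) \<le> p + q" "finite (X i)" "X i \<inter> X j = {}" "X i \<inter> Y i = {}" "X i \<inter> Y j = {}"
    using hex ne unfolding hexagon_def by simp_all
  show "2 * (p + q) < card (X i) + card (X j) + card (X k)"
    using hex distinct_indices_sum[OF ijk, of "\<lambda>i. card (X i)"]
    unfolding hexagon_def by metis
  have Y: "2 * (p + q) < card (Y i) + card (Y j) + card (Y k)"
    using hex distinct_indices_sum[OF ijk, of "\<lambda>i. card (Y i)"]
    unfolding hexagon_def by metis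
  have "card (Y i) \<le> p + q" and fin: "finite (Y j)" "finite (Y k)" and "Y j \<inter> Y k = {}"
    using hex ne unfolding hexagon_def by simp_all
  then show big: "p + q < card (Y j \<union> Y k)"
    using Y by (simp add: card_Un_disjoint)
  show "X i \<subseteq> S \<union> T" by (rule joined_covered[OF J big])
qed

text \<open>Cutting the hexagon between the adjacent parts \<open>X j\<close> and \<open>Y i\<close>
  gives the path \<open>Y i - X k - Y j - X i - Y k - X j\<close>. If its ends have at most
  \<open>p + q\<close> vertices together, the total of more than \<open>4 * (p + q)\<close> leaves
  enough in the inner parts to contradict \<open>no_path\<close>.\<close>

lemma hexagon_pair_large:
  assumes hex: "hexagon X Y" and ijk: "distinct_indices i j k"
  shows "p + q < card (X j) + card (Y i)"
proof (rule ccontr)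
  assume small: "\<not> ?thesis"
  note jik = distinct_indices_rot(1)[OF ijk] and kij = distinct_indices_rot(2)[OF ijk]
    and ikj = distinct_indices_rot(3)[OF ijk] and kji = distinct_indices_rot(4)[OF ijk]
    and jki = distinct_indices_rot(5)[OF ijk]
  note XD = hexagonD[OF hex] and YD = hexagonD[OF hexagon_swap[OF hex]]
  note disj = XD(7)[OF ikj] YD(7)[OF jki] XD(9)[OF ijk] XD(9)[OF ikj] XD(9)[OF kji] XD(8)[OF kij]
  have fin: "finite (X i)" "finite (X k)" "finite (Y j)" "finite (Y k)"
    using XD(6)[OF ijk] XD(6)[OF kij] YD(6)[OF jik] YD(6)[OF kij] .
  have pair: "card (X i \<union> Y j) = card (X i) + card (Y j)"
    by (rule card_Un_disjoint[OF fin(1,3) XD(9)[OF ijk]])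
  have "card ((X i \<union> Y j) \<union> (X k \<union> Y k)) = card (X i \<union> Y j) + card (X k \<union> Y k)"
    by (rule card_Un_disjoint) (use fin disj in auto)
  moreover have "card (X k \<union> Y k) = card (X k) + card (Y k)"
    by (rule card_Un_disjoint[OF fin(2,4) XD(8)[OF kij]])
  ultimately have all: "card (X i \<union> Y j \<union> X k \<union> Y k) = card (X i) + card (Y j) + card (X k) + card (Y k)"
    using pair by (simp add: Un_assoc)
  note sizes = XD(5)[OF kij] YD(5)[OF kij] XD(4)[OF ijk] YD(4)[OF ijk] small
  have lg: "p + q < card (X i \<union> Y j)" "3 * (p + q) < card (X i \<union> Y j \<union> X k \<union> Y k)"
    unfolding pair all using sizes by simp_all
  show False
    by (rule no_path[OF XD(1)[OF ijk] YD(1)[OF jik] XD(1)[OF kij] YD(1)[OF kji]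
          XD(2)[OF ijk] YD(2)[OF jik] XD(2)[OF kij] YD(2)[OF kji] lg fin(1,3,2,4)])
      (use disj in auto)
qed

text \<open>The two crossings would split the six parts into two groups of at most
  \<open>2 * (p + q)\<close> vertices each, while there are more than \<open>4 * (p + q)\<close>
  vertices in all.\<close>

lemma hexagon_not_both_cross:
  assumes hex: "hexagon X Y" and ijk: "distinct_indices i j k"
  shows "\<not> (cross (X i) (Y j \<union> Y k) \<and> cross (Y i) (X j \<union> X k))"
proof
  assume "cross (X i) (Y j \<union> Y k) \<and> cross (Y i) (X j \<union> X k)"
  then have cross: "cross (X i) (Y j \<union> Y k)" "cross (Y i) (X j \<union> X k)" by simp_all
  note jik = distinct_indices_rot(1)[OF ijk] and kij = distinct_indices_rot(2)[OF ijk]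
    and ikj = distinct_indices_rot(3)[OF ijk] and jki = distinct_indices_rot(5)[OF ijk]
  note XD = hexagonD[OF hex] and YD = hexagonD[OF hexagon_swap[OF hex]]
  note cov = XD(3)[OF ijk] XD(3)[OF jik] XD(3)[OF kij] YD(3)[OF ijk] YD(3)[OF jik] YD(3)[OF kij]
  note fin = XD(6)[OF ijk] XD(6)[OF jik] XD(6)[OF kij] YD(6)[OF ijk] YD(6)[OF jik] YD(6)[OF kij]
  have disj: "X i \<inter> (Y j \<union> Y k) = {}" "Y i \<inter> (X j \<union> X k) = {}"
    using XD(9)[OF ijk] XD(9)[OF ikj] YD(9)[OF ijk] YD(9)[OF ikj] by blast+
  have "card (X i \<union> (Y j \<union> Y k)) = card (X i) + (card (Y j) + card (Y k))"
    "card (Y i \<union> (X j \<union> X k)) = card (Y i) + (card (X j) + card (X k))"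
    using fin disj XD(7)[OF jki] YD(7)[OF jki] by (simp_all add: card_Un_disjoint)
  moreover have "real (card (X i \<union> (Y j \<union> Y k))) \<le> 2 * (p + q)"
    "real (card (Y i \<union> (X j \<union> X k))) \<le> 2 * (p + q)"
    using cross_card_le[OF cross(1)] cross_card_le[OF cross(2)] cov by simp_all
  ultimately show False
    using XD(4)[OF ijk] YD(4)[OF ijk] by simp
qed

text \<open>The adjacent parts \<open>X i\<close> and \<open>Y j\<close> are jointly large, whereas
  \<open>not_cross_pair\<close> makes their union small if neither crosses.\<close>

lemma hexagon_one_cross:
  assumes hex: "hexagon X Y" and ijk: "distinct_indices i j k"
  shows "cross (X i) (Y j \<union> Y k) \<or> cross (Y j) (X i \<union> X k)"
proof (rule ccontr)
  assume neg: "\<not> ?thesis"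
  note jik = distinct_indices_rot(1)[OF ijk] and kij = distinct_indices_rot(2)[OF ijk]
  note XD = hexagonD[OF hex] and YD = hexagonD[OF hexagon_swap[OF hex]]
  have large: "p + q < card (X i) + card (Y j)"
    by (rule hexagon_pair_large[OF hex jik])
  note le = XD(5)[OF ijk] YD(5)[OF jik] and fin = XD(6)[OF ijk] YD(6)[OF jik]
  have ne: "X i \<noteq> {}" "Y j \<noteq> {}" using large le by auto
  note cov = XD(3)[OF ijk] XD(3)[OF kij] YD(3)[OF jik] YD(3)[OF kij]
  have "card (X i \<union> Y j) \<le> p + q"
    by (rule not_cross_pair[OF XD(1)[OF ijk] XD(2)[OF ijk] _ _ YD(1)[OF jik] YD(2)[OF jik]])
      (use neg cov ne in auto)
  then show False using large card_Un_disjoint[OF fin XD(9)[OF ijk]] by simp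
qed

text \<open>Each \<open>X j\<close> meets two classes of each colour, so a neighbouring part that
  does not cross has constant classes. The parts of \<open>Y\<close> thus use at most three classes
  of each colour and those of \<open>X\<close> no others, so the hexagon has at most
  \<open>3 * (p + q)\<close> vertices, too few for its two sides.\<close>

lemma hexagon_not_all_left_cross:
  assumes hex: "hexagon X Y"
    and cross: "\<And>i j k. distinct_indices i j k \<Longrightarrow> cross (X i) (Y j \<union> Y k)"
    and not_cross: "\<And>i j k. distinct_indices i j k \<Longrightarrow> \<not> cross (Y i) (X j \<union> X k)"
  shows False
proof -
  note XD = hexagonD[OF hex] and YD = hexagonD[OF hexagon_swap[OF hex]]
  have const: "\<exists>c. \<forall>y\<in>Y i. (f y, g y) = c" if ijk: "distinct_indices i j k" for i j k
  proof (cases "Y i = {}")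
    case False
    have cov: "X j \<union> X k \<subseteq> S \<union> T"
      using XD(3)[OF distinct_indices_rot(1)[OF ijk]] XD(3)[OF distinct_indices_rot(2)[OF ijk]] by simp
    obtain a b c d where ab: "f ` X j = {a, b}" "g ` X j = {c, d}" "a \<noteq> b" "c \<noteq> d"
      using cross_ranges[OF cross[OF distinct_indices_rot(1)[OF ijk]]] by metis
    from YD(1)[OF ijk] YD(2)[OF ijk] cov not_cross[OF ijk] False show ?thesis
    proof (cases rule: not_cross_cases)
      case (first m)
      then have "{a, b} \<subseteq> {m}" using ab(1) by blast
      then show ?thesis using ab(3) by auto
    next
      case (second m)
      then have "{c, d} \<subseteq> {m}" using ab(2) by blast
      then show ?thesis using ab(4) by auto
    next
      case (const m n)
      then show ?thesis by blast
    qed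
  qed auto
  have "\<exists>c. \<forall>i<3. \<forall>y\<in>Y i. (f y, g y) = c i"
  proof -
    have "\<exists>c. \<forall>y\<in>Y i. (f y, g y) = c" if "i < 3" for i
    proof -
      from that consider "i = 0" | "i = 1" | "i = 2" by linarith
      then show ?thesis
        using const[of 0 1 2] const[of 1 0 2] const[of 2 0 1]
        by cases (simp_all add: distinct_indices_def)
    qed
    then show ?thesis by metis
  qed
  then obtain c where c: "\<And>i y. i < 3 \<Longrightarrow> y \<in> Y i \<Longrightarrow> (f y, g y) = c i" by blast
  let ?F = "(fst \<circ> c) ` {..<3}" and ?G = "(snd \<circ> c) ` {..<3}"
  have Y: "f ` Y i \<subseteq> ?F \<and> g ` Y i \<subseteq> ?G" if "i < 3" for i
  proof -
    have "f y = fst (c i) \<and> g y = snd (c i)" if "y \<in> Y i" for y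
      using c[OF \<open>i < 3\<close> that] by (metis fst_conv snd_conv)
    then show ?thesis using that by auto
  qed
  have X: "f ` X i \<subseteq> ?F \<and> g ` X i \<subseteq> ?G" if ijk: "distinct_indices i j k" for i j k
  proof -
    have "f ` X i = f ` (Y j \<union> Y k) \<and> g ` X i = g ` (Y j \<union> Y k)"
      by (rule cross_ranges[OF cross[OF ijk]]) simp
    then show ?thesis
      using Y ijk[unfolded distinct_indices_def] by (simp add: image_Un)
  qed
  have idx: "distinct_indices 0 1 2" "distinct_indices 1 0 2" "distinct_indices 2 0 1"
    unfolding distinct_indices_def by simp_all
  let ?V = "(X 0 \<union> X 1 \<union> X 2) \<union> (Y 0 \<union> Y 1 \<union> Y 2)"
  have "real (card ?V) \<le> real 3 * p + real 3 * q"
  proof (rule card_covered_le)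
    show "?V \<subseteq> S \<union> T" using XD(3)[OF idx(1)] XD(3)[OF idx(2)] XD(3)[OF idx(3)] YD(3)[OF idx(1)] YD(3)[OF idx(2)]
        YD(3)[OF idx(3)] by simp
    show "f ` ?V \<subseteq> ?F" "g ` ?V \<subseteq> ?G"
      using X[OF idx(1)] X[OF idx(2)] X[OF idx(3)] Y[of 0] Y[of 1] Y[of 2] by (simp_all add: image_Un)
    show "card ?F \<le> 3" "card ?G \<le> 3"
      using card_image_le[of "{..<3}" "fst \<circ> c"] card_image_le[of "{..<3}" "snd \<circ> c"] by simp_all
  qed simp_all
  moreover have "card ?V = card (X 0) + card (X 1) + card (X 2) + (card (Y 0) + card (Y 1) + card (Y 2))"
  proof -
    have fin: "finite (X 0)" "finite (X 1)" "finite (X 2)" "finite (Y 0)" "finite (Y 1)" "finite (Y 2)"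
      using hex unfolding hexagon_def by simp_all
    have "X 0 \<inter> X 1 = {}" "(X 0 \<union> X 1) \<inter> X 2 = {}" "Y 0 \<inter> Y 1 = {}" "(Y 0 \<union> Y 1) \<inter> Y 2 = {}"
      "(X 0 \<union> X 1 \<union> X 2) \<inter> (Y 0 \<union> Y 1 \<union> Y 2) = {}"
      using hex unfolding hexagon_def by (simp_all add: Int_Un_distrib Int_Un_distrib2)
    then show ?thesis using fin by (simp add: card_Un_disjoint)
  qed
  moreover have "2 * (p + q) < card (X 0) + card (X 1) + card (X 2)"
    "2 * (p + q) < card (Y 0) + card (Y 1) + card (Y 2)"
    using XD(4)[OF idx(1)] YD(4)[OF idx(1)] by simp_all
  ultimately show False using bounds_nonneg by simp
qed

lemma no_hexagon: "\<not> hexagon X Y"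
proof
  assume hex: "hexagon X Y"
  note hex' = hexagon_swap[OF hex]
  have one: "cross (X i) (Y j \<union> Y k) \<or> cross (Y j) (X i \<union> X k)" if "distinct_indices i j k" for i j k
    using hexagon_one_cross[OF hex that] .
  have both: "\<not> (cross (X i) (Y j \<union> Y k) \<and> cross (Y i) (X j \<union> X k))" if "distinct_indices i j k" for i j k
    using hexagon_not_both_cross[OF hex that] .
  have idx: "distinct_indices 0 1 2" "distinct_indices 1 0 2" "distinct_indices 2 0 1"
    "distinct_indices 0 2 1" "distinct_indices 1 2 0" "distinct_indices 2 1 0"
    unfolding distinct_indices_def by simp_all
  define x where "x = (\<lambda>i. cross (X i) (\<Union>(Y ` ({..<3} - {i}))))"
  define y where "y = (\<lambda>i. cross (Y i) (\<Union>(X ` ({..<3} - {i}))))"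
  have nbrs: "\<Union>(h ` ({..<3} - {i})) = h j \<union> h k" if "distinct_indices i j k" for h :: "nat \<Rightarrow> 'v set" and i j k
  proof -
    have "m \<in> {..<3} - {i} \<longleftrightarrow> m \<in> {j, k}" for m
      using that unfolding distinct_indices_def by auto
    then have "{..<3} - {i} = {j, k}" by blast
    then show ?thesis by simp
  qed
  have xc: "x i \<longleftrightarrow> cross (X i) (Y j \<union> Y k)" and yc: "y i \<longleftrightarrow> cross (Y i) (X j \<union> X k)"
    if "distinct_indices i j k" for i j k
    unfolding x_def y_def nbrs[OF that] by simp_all
  have "x i \<or> y j" if "distinct_indices i j k" for i j k
    using one[OF that] xc[OF that] yc[OF distinct_indices_rot(1)[OF that]] by blast
  then have "x 0 \<or> y 1" "x 0 \<or> y 2" "x 1 \<or> y 0" "x 1 \<or> y 2" "x 2 \<or> y 0" "x 2 \<or> y 1"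
    using idx by blast+
  moreover have "\<not> (x i \<and> y i)" if "distinct_indices i j k" for i j k
    using both[OF that] xc[OF that] yc[OF that] by blast
  then have "\<not> (x 0 \<and> y 0)" "\<not> (x 1 \<and> y 1)" "\<not> (x 2 \<and> y 2)" using idx by blast+
  \<comment> \<open>Of two adjacent parts at least one crosses and of two opposite parts at most
    one, so all three parts of one side cross and none of the other.\<close>
  ultimately consider "\<forall>i\<in>{0, 1, 2}. x i \<and> \<not> y i" | "\<forall>i\<in>{0, 1, 2}. y i \<and> \<not> x i" by auto
  then show False
  proof cases
    case 1
    have "x i \<and> \<not> y i" if "distinct_indices i j k" for i j k
      using 1 that[unfolded distinct_indices_def] by (auto simp: less_Suc_eq numeral_3_eq_3 numeral_2_eq_2)
    then show False
      using hexagon_not_all_left_cross[OF hex] xc yc by blast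
  next
    case 2
    have "y i \<and> \<not> x i" if "distinct_indices i j k" for i j k
      using 2 that[unfolded distinct_indices_def] by (auto simp: less_Suc_eq numeral_3_eq_3 numeral_2_eq_2)
    then show False
      using hexagon_not_all_left_cross[OF hex'] xc yc by blast
  qed
qed

end

section \<open>Three colours\<close>

text \<open>
  The data of a counterexample: \<open>h\<close> and \<open>W\<close> are the green classes and covers.
\<close>

locale three_cover = two_cover f S p g T q
  for f :: "'v \<Rightarrow> 'c" and S :: "'v set" and p :: real
    and g :: "'v \<Rightarrow> 'e" and T :: "'v set" and q :: real +
  fixes h :: "'v \<Rightarrow> 'h" and W :: "'v set" and r :: real and X Y :: "'v set"
  assumes finite_W: "finite W"
    and card_W: "\<And>m. real (card {v\<in>W. h v = m}) \<le> r"
    and finite_X: "finite X" and finite_Y: "finite Y" and disjoint: "X \<inter> Y = {}"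
    and linked: "\<And>x y. x \<in> X \<Longrightarrow> y \<in> Y \<Longrightarrow>
      joined {x} {y} \<or> h x = h y \<and> (x \<in> W \<or> y \<in> W)"
    and r_large: "p + q \<le> r"
    and X_large: "p + q + r < card X" and Y_large: "p + q + r < card Y"
begin

lemma joined_different:
  assumes "A \<subseteq> X" "B \<subseteq> Y" "\<And>x y. x \<in> A \<Longrightarrow> y \<in> B \<Longrightarrow> h x = h y \<Longrightarrow> x \<notin> W \<and> y \<notin> W"
  shows "joined A B" "joined B A"
proof -
  show "joined A B"
    using linked assms unfolding joined_def by blast
  then show "joined B A" by (simp add: joined_commute)
qed

text \<open>If the vertices with class in \<open>J\<close> are many on one side,
  \<open>joined_card_le\<close> makes those outside \<open>J\<close> few on the other. Those in
  \<open>J\<close> then exceed \<open>r\<close>, hence \<open>p + q\<close>, there, and the argument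
  returns to the first side.\<close>

lemma small_or_large:
  assumes "card {x\<in>X. h x \<in> J} > p + q \<or> card {y\<in>Y. h y \<in> J} > p + q"
  shows "card {x\<in>X. h x \<in> J} > r" "card {y\<in>Y. h y \<in> J} > r"
    "card {x\<in>X. h x \<notin> J} \<le> p + q" "card {y\<in>Y. h y \<notin> J} \<le> p + q"
proof -
  have split: "card {v\<in>V. h v \<in> J} + card {v\<in>V. h v \<notin> J} = card V" if "finite V" for V
  proof -
    have "card ({v\<in>V. h v \<in> J} \<union> {v\<in>V. h v \<notin> J}) = card {v\<in>V. h v \<in> J} + card {v\<in>V. h v \<notin> J}"
      by (rule card_Un_disjoint) (use that in auto)
    moreover have "{v\<in>V. h v \<in> J} \<union> {v\<in>V. h v \<notin> J} = V" by blast
    ultimately show ?thesis by simp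
  qed
  have "joined {x\<in>X. h x \<in> J} {y\<in>Y. h y \<notin> J}"
    by (rule joined_different) auto
  then have 1: "card {x\<in>X. h x \<in> J} \<le> p + q \<or> card {y\<in>Y. h y \<notin> J} \<le> p + q"
    by (rule joined_card_le) (use finite_X finite_Y disjoint in auto)
  have "joined {x\<in>X. h x \<notin> J} {y\<in>Y. h y \<in> J}"
    by (rule joined_different) auto
  then have 2: "card {x\<in>X. h x \<notin> J} \<le> p + q \<or> card {y\<in>Y. h y \<in> J} \<le> p + q"
    by (rule joined_card_le) (use finite_X finite_Y disjoint in auto)
  have sizes: "real (card {x\<in>X. h x \<in> J}) + card {x\<in>X. h x \<notin> J} = card X"
    "real (card {x\<in>Y. h x \<in> J}) + card {x\<in>Y. h x \<notin> J} = card Y"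
    unfolding split[OF finite_X, symmetric] split[OF finite_Y, symmetric] by simp_all
  show "card {x\<in>X. h x \<in> J} > r" "card {y\<in>Y. h y \<in> J} > r"
    "card {x\<in>X. h x \<notin> J} \<le> p + q" "card {y\<in>Y. h y \<notin> J} \<le> p + q"
    using 1 2 sizes assms r_large X_large Y_large by linarith+
qed

text \<open>Uncovered vertices of class \<open>m\<close> are not linked in green, so a large class
  gives the path \<open>?Q - ?U - ?B - ?A - ?V - ?P\<close>. The cover of \<open>m\<close> takes at
  most \<open>r\<close> vertices from both sides together, and the inner sets stay large enough for
  \<open>no_path\<close>.\<close>

lemma no_large_class:
  "card {x\<in>X. h x = m} \<le> p + q \<and> card {y\<in>Y. h y = m} \<le> p + q"
proof (rule ccontr)
  assume "\<not> ?thesis"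
  then have "card {x\<in>X. h x \<in> {m}} > p + q \<or> card {y\<in>Y. h y \<in> {m}} > p + q" by auto
  from small_or_large[OF this]
  have large: "card {x\<in>X. h x = m} > r" "card {y\<in>Y. h y = m} > r"
    and small: "card {x\<in>X. h x \<noteq> m} \<le> p + q" "card {y\<in>Y. h y \<noteq> m} \<le> p + q"
    by simp_all
  let ?A = "{x\<in>X. h x = m \<and> x \<notin> W}" and ?P = "{x\<in>X. h x = m \<and> x \<in> W}" and ?U = "{x\<in>X. h x \<noteq> m}"
  let ?B = "{y\<in>Y. h y = m \<and> y \<notin> W}" and ?Q = "{y\<in>Y. h y = m \<and> y \<in> W}" and ?V = "{y\<in>Y. h y \<noteq> m}"
  have PA: "?P \<union> ?A = {x\<in>X. h x = m}" and QB: "?Q \<union> ?B = {y\<in>Y. h y = m}" by blast+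
  have "card (?P \<union> ?Q) \<le> card {v\<in>W. h v = m}"
    by (rule card_mono) (use finite_W in auto)
  moreover have "card (?P \<union> ?Q) = card ?P + card ?Q"
    by (rule card_Un_disjoint) (use finite_X finite_Y disjoint in auto)
  ultimately have PQ: "real (card ?P) + card ?Q \<le> r" using card_W[of m] by simp
  have "card (?A \<union> ?P \<union> ?U) = card ?A + card ?P + card ?U"
    by (subst card_Un_disjoint, use finite_X in auto)+
  moreover have "?A \<union> ?P \<union> ?U = X" by blast
  ultimately have X: "real (card ?A) + card ?P + card ?U = card X" by simp
  have "card (?B \<union> ?Q \<union> ?V) = card ?B + card ?Q + card ?V"
    by (subst card_Un_disjoint, use finite_Y in auto)+
  moreover have "?B \<union> ?Q \<union> ?V = Y" by blast
  ultimately have Y: "real (card ?B) + card ?Q + card ?V = card Y" by simp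
  have cards: "card (?B \<union> ?V) = card ?B + card ?V" "card (?A \<union> ?U) = card ?A + card ?U"
    "card (?A \<union> ?B) = card ?A + card ?B" "card (?A \<union> ?B \<union> ?U \<union> ?V) = card ?A + card ?B + card ?U + card ?V"
    by (subst card_Un_disjoint, use finite_X finite_Y disjoint in auto)+
  show False
  proof (rule no_path)
    show "joined ?A (?B \<union> ?V)" "joined ?U (?Q \<union> ?B)" by (rule joined_different(1); auto)+
    show "joined ?B (?A \<union> ?U)" "joined ?V (?P \<union> ?A)" by (rule joined_different(2); auto)+
    show "p + q < card (?Q \<union> ?B)" "p + q < card (?P \<union> ?A)"
      unfolding PA QB using large r_large by simp_all
    show "p + q < card (?B \<union> ?V)" "p + q < card (?A \<union> ?U)" "p + q < card (?A \<union> ?B)"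
      "3 * (p + q) < card (?A \<union> ?B \<union> ?U \<union> ?V)"
      unfolding cards using X Y PQ X_large Y_large small r_large by simp_all
  qed (use finite_X finite_Y disjoint in auto)
qed

text \<open>A smallest large set \<open>J\<close> of green classes splits the classes into one class
  \<open>m\<close>, the rest of \<open>J\<close> and the complement. These groups are small on both
  sides by \<open>no_large_class\<close>, by minimality and by \<open>small_or_large\<close>. No
  green link joins different groups, so they form a hexagon.\<close>

lemma inconsistent: False
proof -
  let ?J = "\<lambda>J. card {x\<in>X. h x \<in> J} > p + q \<or> card {y\<in>Y. h y \<in> J} > p + q"
  have pos: "0 \<le> p + q" using bounds_nonneg by simp
  \<comment> \<open>Finiteness is demanded so that removing a class lowers the cardinality.\<close>
  define big where "big = (\<lambda>J. finite J \<and> ?J J)"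
  have "big (h ` (X \<union> Y))"
  proof -
    have "{x\<in>X. h x \<in> h ` (X \<union> Y)} = X" by blast
    then have "p + q < card {x\<in>X. h x \<in> h ` (X \<union> Y)}" using X_large r_large pos by simp
    then show ?thesis unfolding big_def using finite_X finite_Y by blast
  qed
  from ex_has_least_nat[of big, OF this, of card]
  obtain J where "big J" and min: "\<forall>J'. big J' \<longrightarrow> card J \<le> card J'" by blast
  then have J: "finite J" "?J J" unfolding big_def by blast+
  have "J \<noteq> {}" using J(2) pos by auto
  then obtain m where m: "m \<in> J" by blast
  have "\<not> big (J - {m})"
    using min card_Diff1_less[OF J(1) m] by (meson not_le)
  then have rest: "card {x\<in>X. h x \<in> J - {m}} \<le> p + q" "card {y\<in>Y. h y \<in> J - {m}} \<le> p + q"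
    using J(1) unfolding big_def by auto
  define part where "part = (\<lambda>V (i::nat). {v\<in>V. if i = 0 then h v = m else if i = 1 then h v \<in> J - {m} else h v \<notin> J})"
  have part: "part V 0 = {v\<in>V. h v = m}" "part V 1 = {v\<in>V. h v \<in> J - {m}}" "part V 2 = {v\<in>V. h v \<notin> J}" for V
    unfolding part_def by auto
  have diff: "h x \<noteq> h y" if "x \<in> part V i" "y \<in> part V' j" "i \<noteq> j" "i < 3" "j < 3" for x y i j V V'
    using that m by (auto simp: part_def less_Suc_eq numeral_3_eq_3 split: if_splits)
  have sub: "part V i \<subseteq> V" for V i by (auto simp: part_def)
  have sum: "real (card (part V 0)) + card (part V 1) + card (part V 2) = card V" if "finite V" for V
  proof -
    have "card (part V 0 \<union> part V 1 \<union> part V 2) = card (part V 0) + card (part V 1) + card (part V 2)"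
      using that m unfolding part by (subst card_Un_disjoint; auto)+
    moreover have "part V 0 \<union> part V 1 \<union> part V 2 = V" using m unfolding part by blast
    ultimately show ?thesis by simp
  qed
  have "hexagon (part X) (part Y)"
    unfolding hexagon_def
  proof (intro conjI allI impI)
    fix i j :: nat assume ij: "i < 3" "j < 3" "i \<noteq> j"
    show "joined (part X i) (part Y j)"
      by (rule joined_different(1)) (use sub diff ij in blast)+
    show "joined (part Y i) (part X j)"
      by (rule joined_different(2)) (use sub diff[of _ X j _ Y i] ij in blast)+
    show "part X i \<inter> part X j = {}" "part Y i \<inter> part Y j = {}" using diff ij by blast+
  next
    fix i j :: nat
    show "part X i \<inter> part Y j = {}" "part Y i \<inter> part X j = {}" using sub disjoint by blast+
  next
    fix i :: nat assume "i < 3"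
    show "finite (part X i)" "finite (part Y i)" using finite_subset[OF sub] finite_X finite_Y by blast+
    have "i = 0 \<or> i = 1 \<or> i = 2" using \<open>i < 3\<close> by linarith
    then show "card (part X i) \<le> p + q" "card (part Y i) \<le> p + q"
      using no_large_class[of m] rest small_or_large(3,4)[OF J(2)] by (auto simp: part simp del: One_nat_def)
  next
    show "2 * (p + q) < card (part X 0) + card (part X 1) + card (part X 2)"
      "2 * (p + q) < card (part Y 0) + card (part Y 1) + card (part Y 2)"
      using sum[OF finite_X] sum[OF finite_Y] X_large Y_large r_large by simp_all
  qed
  then show False using no_hexagon by blast
qed

end

section \<open>Covers of monochromatic components\<close>

definition vertex_cover :: "('a \<times> 'b) set \<Rightarrow> 'a set \<Rightarrow> 'b set \<Rightarrow> bool" where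
  "vertex_cover E A B \<longleftrightarrow> finite A \<and> finite B \<and> (\<forall>(x, y)\<in>E. x \<in> A \<or> y \<in> B)"

text \<open>
  For two edges at \<open>x\<close>, uncrossing the small covers of the graph without the one and without the other
  gives two covers of the whole graph, of total size at most \<open>2 * t - 1\<close>.
\<close>

lemma critical_edges_disjoint:
  assumes tight: "\<And>A B. vertex_cover F A B \<Longrightarrow> t \<le> card A + card B"
    and critical: "\<And>e. e \<in> F \<Longrightarrow> \<exists>A B. vertex_cover (F - {e}) A B \<and> card A + card B < t"
    and xy: "(x, y) \<in> F" "(x, z) \<in> F"
  shows "y = z"
proof (rule ccontr)
  assume "y \<noteq> z"
  obtain A B where AB: "vertex_cover (F - {(x, y)}) A B" "card A + card B < t"
    using critical xy(1) by blast
  obtain C D where CD: "vertex_cover (F - {(x, z)}) C D" "card C + card D < t"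
    using critical xy(2) by blast
  have fin: "finite A" "finite B" "finite C" "finite D"
    using AB(1) CD(1) unfolding vertex_cover_def by auto
  have "x \<notin> A"
  proof
    assume "x \<in> A"
    then have "vertex_cover F A B" using AB(1) unfolding vertex_cover_def by auto
    then show False using tight AB(2) by (meson not_le)
  qed
  then have z: "z \<in> B" using AB(1) xy(2) \<open>y \<noteq> z\<close> unfolding vertex_cover_def by blast
  have "x \<notin> C"
  proof
    assume "x \<in> C"
    then have "vertex_cover F C D" using CD(1) unfolding vertex_cover_def by auto
    then show False using tight CD(2) by (meson not_le)
  qed
  then have y: "y \<in> D" using CD(1) xy(1) \<open>y \<noteq> z\<close> unfolding vertex_cover_def by blast
  have "vertex_cover F (A \<inter> C) (B \<union> D)" "vertex_cover F (insert x (A \<union> C)) (B \<inter> D)"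
    using AB(1) CD(1) y z unfolding vertex_cover_def by auto
  then have "t \<le> card (A \<inter> C) + card (B \<union> D)" "t \<le> card (insert x (A \<union> C)) + card (B \<inter> D)"
    using tight by blast+
  moreover have "card (insert x (A \<union> C)) \<le> Suc (card (A \<union> C))" by (rule card_insert_le_m1) auto
  moreover have "card A + card C = card (A \<union> C) + card (A \<inter> C)"
    "card B + card D = card (B \<union> D) + card (B \<inter> D)"
    by (rule card_Un_Int[OF fin(1,3)], rule card_Un_Int[OF fin(2,4)])
  ultimately show False using AB(2) CD(2) by linarith
qed

text \<open>Let \<open>t\<close> be the least cover size of \<open>E\<close>, and take a smallest
  \<open>M\<close> among the sets of edges that still need \<open>t\<close> vertices. It is
  critical, so \<open>critical_edges_disjoint\<close>, applied also to the converse relation, makes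
  it a matching; as its left ends cover it, it has at least \<open>t\<close> edges.\<close>

theorem koenig:
  assumes "finite E"
  obtains M A B where "M \<subseteq> E" "inj_on fst M" "inj_on snd M"
    "vertex_cover E A B" "card A + card B \<le> card M"
proof -
  have cov: "vertex_cover F (fst ` F) {}" if "finite F" for F :: "('a \<times> 'b) set"
    using that unfolding vertex_cover_def by force
  from ex_has_least_nat[of "\<lambda>(A, B). vertex_cover E A B" "(fst ` E, {})" "\<lambda>(A, B). card A + card B"]
  obtain A B where AB: "vertex_cover E A B"
    and min: "\<And>A' B'. vertex_cover E A' B' \<Longrightarrow> card A + card B \<le> card A' + card B'"
    using cov[OF assms] by fastforce
  define t where "t = card A + card B"
  define tight where "tight = (\<lambda>F. F \<subseteq> E \<and> (\<forall>A B. vertex_cover F A B \<longrightarrow> t \<le> card A + card B))"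
  have "tight E" unfolding tight_def t_def using min by blast
  from ex_has_least_nat[of tight, OF this, of card]
  obtain M where M: "tight M" and least: "\<forall>F. tight F \<longrightarrow> card M \<le> card F" by blast
  have fin: "finite M" using M assms finite_subset unfolding tight_def by blast
  have tightM: "t \<le> card A + card B" if "vertex_cover M A B" for A B
    using M that unfolding tight_def by blast
  have critical: "\<exists>A B. vertex_cover (M - {e}) A B \<and> card A + card B < t" if "e \<in> M" for e
  proof -
    have "\<not> tight (M - {e})" using least card_Diff1_less[OF fin that] by (meson not_le)
    moreover have "M - {e} \<subseteq> E" using M unfolding tight_def by blast
    ultimately show ?thesis unfolding tight_def by (meson not_le)
  qed
  have conv: "vertex_cover (F\<inverse>) B A \<longleftrightarrow> vertex_cover F A B" for F :: "('a \<times> 'b) set" and A B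
    unfolding vertex_cover_def by auto
  have "inj_on fst M"
    using critical_edges_disjoint[OF tightM critical] by (auto intro!: inj_onI)
  moreover have "inj_on snd M"
  proof -
    have 1: "t \<le> card A + card B" if "vertex_cover (M\<inverse>) A B" for A B
      using tightM conv that by (metis add.commute)
    have 2: "\<exists>A B. vertex_cover (M\<inverse> - {e}) A B \<and> card A + card B < t" if e: "e \<in> M\<inverse>" for e
    proof -
      have "(snd e, fst e) \<in> M" using e by (cases e) auto
      moreover have "(M - {(snd e, fst e)})\<inverse> = M\<inverse> - {e}" by (cases e) auto
      ultimately show ?thesis using critical conv by (metis add.commute)
    qed
    show ?thesis
      using critical_edges_disjoint[OF 1 2] by (auto intro!: inj_onI)
  qed
  moreover have "card A + card B \<le> card M"
    using tightM[OF cov[OF fin]] card_image_le[OF fin, of fst] unfolding t_def by simp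
  ultimately show thesis using that[of M A B] M AB unfolding tight_def by blast
qed

text \<open>The label \<open>l\<close> is the component in colour \<open>k\<close>. No component has
  a matching of \<open>t\<close> edges, so Koenig's theorem covers its edges by at most
  \<open>t\<close> vertices; \<open>S\<close> consists of the vertices in the cover of their own
  component.\<close>

lemma component_cover:
  fixes G :: "'a pair_pre_digraph" and c :: "'a set \<Rightarrow> colour"
  assumes "pair_graph G" and bip: "bipartition G V W"
    and no: "\<And>H. \<not> connected_matching G c k t H"
  obtains S and l :: "'a \<Rightarrow> 'a set" where "S \<subseteq> pverts G" "\<And>C. card {v\<in>S. l v = C} \<le> t"
    "\<And>x y. x \<in> V \<Longrightarrow> y \<in> W \<Longrightarrow> (x, y) \<in> parcs G \<Longrightarrow> c {x, y} = k \<Longrightarrow> l x = l y \<and> (x \<in> S \<or> y \<in> S)"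
proof -
  interpret G: pair_graph G by fact
  let ?D = "colour_subgraph G c k"
  have Dv: "pverts ?D = pverts G" and Da: "parcs ?D = {(u, v). (u, v) \<in> parcs G \<and> c {u, v} = k}"
    unfolding colour_subgraph_def by simp_all
  interpret D: pair_graph ?D
  proof
    show "finite (pverts ?D)" unfolding Dv by (rule G.pair_finite_verts)
    show "finite (parcs ?D)" by (rule finite_subset[OF _ G.pair_finite_arcs]) (auto simp: Da)
    show "symmetric (with_proj ?D)"
      unfolding symmetric_def by (auto simp: Da sym_def insert_commute G.arcs_symmetric)
  qed (auto simp: Dv Da dest: G.wellformed' G.pair_no_loops)
  let ?l = "pre_digraph.scc_of (with_proj ?D)"
  have disj: "V \<inter> W = {}" and VW: "V \<union> W = pverts G" using bip unfolding bipartition_def by auto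
  have cover: "\<exists>K. finite K \<and> card K \<le> t \<and>
      (\<forall>x\<in>V \<inter> C. \<forall>y\<in>W \<inter> C. (x, y) \<in> parcs ?D \<longrightarrow> x \<in> K \<or> y \<in> K)"
    if C: "C \<in> ?l ` pverts G" for C
  proof -
    let ?H = "with_proj ?D \<restriction> C"
    have "C \<in> D.sccs_verts" using C D.scc_of_in_sccs_verts Dv by auto
    then have scc: "?H \<in> D.sccs" by (rule D.in_verts_sccsD_sccs)
    let ?E = "{(x, y). x \<in> V \<inter> C \<and> y \<in> W \<inter> C \<and> (x, y) \<in> parcs ?D}"
    have "finite ?E" by (rule finite_subset[OF _ D.pair_finite_arcs]) auto
    then obtain M A B where M: "M \<subseteq> ?E" "inj_on fst M" "inj_on snd M"
      and AB: "vertex_cover ?E A B" "card A + card B \<le> card M" by (rule koenig)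
    have edges_H: "{x, y} \<in> edges ?H" if "x \<in> C" "y \<in> C" "(x, y) \<in> parcs ?D" for x y
      unfolding edges_def by (rule image_eqI[of _ _ "(x, y)"]) (use that in \<open>auto simp: induce_subgraph_def\<close>)
    let ?M = "(\<lambda>(x, y). {x, y}) ` M"
    have ends: "x \<in> V" "y \<in> W" if "(x, y) \<in> M" for x y using M(1) that by auto
    have same: "x = x' \<and> y = y'"
      if "(x, y) \<in> M" "(x', y') \<in> M" "{x, y} \<inter> {x', y'} \<noteq> {}" for x y x' y'
    proof -
      have "x = x' \<or> y = y'" using that ends disj by blast
      then show ?thesis using inj_onD[OF M(2) _ that(1,2)] inj_onD[OF M(3) _ that(1,2)] by auto
    qed
    have "?M \<subseteq> edges ?H" using M(1) edges_H by fast
    moreover have "pairwise disjnt ?M"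
      unfolding pairwise_def disjnt_def using same by fast
    ultimately have matching: "matching ?H ?M" unfolding matching_def by blast
    have "inj_on (\<lambda>(x, y). {x, y}) M"
      by (intro inj_onI) (use same in fast)
    then have card: "card ?M = card M" by (rule card_image)
    have "finite (edges ?H)"
      unfolding edges_def using D.pair_finite_arcs by (auto simp: induce_subgraph_def)
    then have bound: "\<forall>M'. matching ?H M' \<longrightarrow> card M' < Suc (card (edges ?H))"
      unfolding matching_def by (meson card_mono le_imp_less_Suc)
    obtain Mx where Mx: "matching ?H Mx" "\<forall>M'. matching ?H M' \<longrightarrow> card M' \<le> card Mx"
      using ex_has_greatest_nat[of "matching ?H", OF matching bound] by blast
    then have "maximum_matching ?H Mx" unfolding maximum_matching_def by blast
    then have "card Mx < t"
      using no[of ?H] scc unfolding connected_matching_def by (meson not_le)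
    moreover have "card M \<le> card Mx" using Mx(2) matching card by auto
    ultimately have "card (A \<union> B) \<le> t" using AB(2) card_Un_le[of A B] by linarith
    then show ?thesis
      using AB(1) unfolding vertex_cover_def by (intro exI[of _ "A \<union> B"]) auto
  qed
  then obtain K where K: "\<And>C. C \<in> ?l ` pverts G \<Longrightarrow> finite (K C) \<and> card (K C) \<le> t \<and>
      (\<forall>x\<in>V \<inter> C. \<forall>y\<in>W \<inter> C. (x, y) \<in> parcs ?D \<longrightarrow> x \<in> K C \<or> y \<in> K C)" by metis
  let ?S = "{v\<in>pverts G. v \<in> K (?l v)}"
  show thesis
  proof (rule that[of ?S ?l])
    show "card {v\<in>?S. ?l v = C} \<le> t" for C
    proof (cases "C \<in> ?l ` pverts G")
      case True
      have "card {v\<in>?S. ?l v = C} \<le> card (K C)"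
        by (rule card_mono) (use K[OF True] in auto)
      then show ?thesis using K[OF True] by linarith
    next
      case False
      then have "{v\<in>?S. ?l v = C} = {}" by auto
      then show ?thesis by (metis card.empty le0)
    qed
  next
    fix x y assume xy: "x \<in> V" "y \<in> W" "(x, y) \<in> parcs G" "c {x, y} = k"
    then have arc: "(x, y) \<in> parcs ?D" "(y, x) \<in> parcs ?D"
      by (auto simp: Da insert_commute G.arcs_symmetric)
    have reach: "x \<rightarrow>\<^sup>*\<^bsub>with_proj ?D\<^esub> y" "y \<rightarrow>\<^sup>*\<^bsub>with_proj ?D\<^esub> x"
      using arc D.reachable_adjI by auto
    then have "?l x = ?l y"
      unfolding D.scc_of_def by (auto intro: D.reachable_trans)
    moreover have "x \<in> ?l x" "y \<in> ?l y"
      using xy VW Dv D.in_scc_of_self by auto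
    ultimately show "?l x = ?l y \<and> (x \<in> ?S \<or> y \<in> ?S)"
      using K[of "?l x"] xy arc VW by auto
  qed auto
qed

text \<open>Choose a merging that respects the bound \<open>t\<close> and leaves fewest classes. Any
  two classes then have covers of joint size above \<open>t\<close>, so all but at most one have a
  cover of at least \<open>t / 2\<close>; these covers are disjoint, which bounds their number by
  \<open>2 * card V / t\<close>.\<close>

lemma merge_classes:
  fixes f :: "'v \<Rightarrow> 'c" and t :: real
  assumes fin: "finite V" and "S \<subseteq> V" and t: "0 < t" and le: "\<And>i. card {v\<in>S. f v = i} \<le> t"
  obtains \<pi> :: "'c \<Rightarrow> 'c" where "\<And>i. card {v\<in>S. \<pi> (f v) = i} \<le> t"
    "card ((\<lambda>v. \<pi> (f v)) ` V) \<le> 2 * card V / t + 1"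
proof -
  have finS: "finite S" using assms finite_subset by blast
  define good where "good = (\<lambda>\<pi> :: 'c \<Rightarrow> 'c. \<forall>i. card {v\<in>S. \<pi> (f v) = i} \<le> t)"
  have "good id" unfolding good_def using le by simp
  from ex_has_least_nat[of good, OF this, of "\<lambda>\<pi>. card ((\<lambda>v. \<pi> (f v)) ` V)"]
  obtain \<pi> where \<pi>: "good \<pi>"
    and least: "\<And>\<rho>. good \<rho> \<Longrightarrow> card ((\<lambda>v. \<pi> (f v)) ` V) \<le> card ((\<lambda>v. \<rho> (f v)) ` V)" by blast
  let ?I = "(\<lambda>v. \<pi> (f v)) ` V" and ?s = "\<lambda>i. card {v\<in>S. \<pi> (f v) = i}"
  have pair: "t < ?s i + ?s j" if ij: "i \<in> ?I" "j \<in> ?I" "i \<noteq> j" for i j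
  proof (rule ccontr)
    assume small: "\<not> ?thesis"
    define \<rho> where "\<rho> = (\<lambda>x. if \<pi> x = j then i else \<pi> x)"
    have "card {v\<in>S. \<rho> (f v) = m} \<le> t" for m
    proof -
      consider "m = i" | "m = j" | "m \<noteq> i" "m \<noteq> j" by blast
      then show ?thesis
      proof cases
        case 1
        have "card ({v\<in>S. \<pi> (f v) = i} \<union> {v\<in>S. \<pi> (f v) = j}) \<le> ?s i + ?s j" by (rule card_Un_le)
        moreover have "{v\<in>S. \<rho> (f v) = m} = {v\<in>S. \<pi> (f v) = i} \<union> {v\<in>S. \<pi> (f v) = j}"
          using 1 ij(3) unfolding \<rho>_def by auto
        ultimately show ?thesis using small by simp
      next
        case 2
        then have empty: "{v\<in>S. \<rho> (f v) = m} = {}" using ij(3) unfolding \<rho>_def by auto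
        show ?thesis unfolding empty using t by simp
      next
        case 3
        then have "{v\<in>S. \<rho> (f v) = m} = {v\<in>S. \<pi> (f v) = m}" unfolding \<rho>_def by auto
        then show ?thesis using \<pi> unfolding good_def by simp
      qed
    qed
    then have "card ?I \<le> card ((\<lambda>v. \<rho> (f v)) ` V)" by (intro least) (simp add: good_def)
    also have "\<dots> \<le> card (?I - {j})"
      by (rule card_mono) (use fin ij in \<open>auto simp: \<rho>_def\<close>)
    also have "\<dots> < card ?I" by (rule card_Diff1_less) (use fin ij in auto)
    finally show False by simp
  qed
  have sum: "(\<Sum>i\<in>I. real (?s i)) \<le> card V" if "I \<subseteq> ?I" for I
  proof -
    have finI: "finite I" using that fin finite_surj by blast
    have "(\<Sum>i\<in>I. ?s i) = card (\<Union>i\<in>I. {v\<in>S. \<pi> (f v) = i})"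
      by (rule card_UN_disjoint[symmetric]) (use finI finS in auto)
    also have "\<dots> \<le> card V" by (rule card_mono) (use fin assms(2) in auto)
    finally show ?thesis by (simp flip: of_nat_sum)
  qed
  obtain J where J: "J \<subseteq> ?I" "\<forall>i\<in>J. t / 2 \<le> ?s i" "card ?I \<le> card J + 1"
  proof (cases "\<exists>i\<in>?I. ?s i < t / 2")
    case True
    then obtain i where i: "i \<in> ?I" "?s i < t / 2" by blast
    have "\<forall>j\<in>?I - {i}. t / 2 \<le> ?s j" using pair i by fastforce
    moreover have "card ?I \<le> card (?I - {i}) + 1" using i(1) fin by (simp add: card_Diff_singleton)
    ultimately show ?thesis using that[of "?I - {i}"] by blast
  next
    case False
    then show ?thesis using that[of ?I] by (meson not_le le_add1 order_refl)
  qed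
  have "card J * (t / 2) = (\<Sum>i\<in>J. t / 2)" by simp
  also have "\<dots> \<le> (\<Sum>i\<in>J. real (?s i))" by (rule sum_mono) (use J(2) in auto)
  also have "\<dots> \<le> card V" by (rule sum[OF J(1)])
  finally have "card J \<le> 2 * card V / t" using t by (simp add: field_simps)
  then have "card ?I \<le> 2 * card V / t + 1" using J(3) by linarith
  then show thesis using that[of \<pi>] \<pi> unfolding good_def by blast
qed

lemma card_rare_types_le:
  fixes \<tau> :: "'v \<Rightarrow> 'c" and e :: real
  assumes "finite X" "0 \<le> e"
  shows "card {x\<in>X. card {x'\<in>X. \<tau> x' = \<tau> x} \<le> e} \<le> card (\<tau> ` X) * e"
proof -
  let ?R = "{x\<in>X. card {x'\<in>X. \<tau> x' = \<tau> x} \<le> e}"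
  have "?R = (\<Union>c\<in>\<tau> ` ?R. {x\<in>X. \<tau> x = c})" by auto
  then have "card ?R \<le> (\<Sum>c\<in>\<tau> ` ?R. card {x\<in>X. \<tau> x = c})"
    using card_UN_le[of "\<tau> ` ?R" "\<lambda>c. {x\<in>X. \<tau> x = c}"] assms(1) by simp
  then have "real (card ?R) \<le> (\<Sum>c\<in>\<tau> ` ?R. real (card {x\<in>X. \<tau> x = c}))"
    by (simp flip: of_nat_sum)
  also have "\<dots> \<le> (\<Sum>c\<in>\<tau> ` ?R. e)" by (rule sum_mono) auto
  also have "\<dots> = card (\<tau> ` ?R) * e" by simp
  also have "\<dots> \<le> card (\<tau> ` X) * e"
    using assms by (intro mult_right_mono) (auto intro!: card_mono)
  finally show ?thesis .
qed

section \<open>Reduction to the counting problem\<close>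

text \<open>Since \<open>1 \<le> a * n\<close> absorbs the rounding in \<open>N\<close>, one gets
  \<open>N \<le> (K + 1) * (b * n)\<close>; the resulting \<open>4 * (K + 1) + 1\<close> is at most
  \<open>5 * K\<close> because \<open>K\<close> is at least 5.\<close>

lemma few_classes:
  fixes K a n z :: real
  assumes "1 \<le> a * n" "z + 1 \<le> K * a" "0 < a" "0 < n" "5 \<le> K" "N \<le> m * n + 1" "m \<le> z + 1"
    and "a \<le> b"
  shows "2 * (2 * N) / (b * n) + 1 \<le> 5 * K"
proof -
  have "m * n \<le> (z + 1) * n" using assms by (intro mult_right_mono) auto
  also have "\<dots> \<le> K * a * n" using assms by (intro mult_right_mono) auto
  finally have "N \<le> K * (a * n) + a * n" using assms(1,6) by (simp add: mult.assoc)
  also have "\<dots> = (K + 1) * (a * n)" by (simp add: algebra_simps)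
  also have "\<dots> \<le> (K + 1) * (b * n)"
    using assms by (intro mult_left_mono mult_right_mono) auto
  finally have N: "N \<le> (K + 1) * (b * n)" .
  have "0 < b * n" using assms by simp
  moreover have "2 * (2 * N) \<le> 4 * (K + 1) * (b * n)" using N by (simp add: algebra_simps)
  ultimately have "2 * (2 * N) / (b * n) \<le> 4 * (K + 1)" by (simp only: pos_divide_le_eq)
  then show ?thesis using assms(5) by simp
qed

text \<open>Vertices of rare type are removed from \<open>X0\<close> alone, so only its bound has an
  error term: there are at most \<open>8 * m ^ 3\<close> types, and a rare one has at most
  \<open>e\<close> vertices. The rest would satisfy \<open>three_cover\<close>, which is
  inconsistent.\<close>

lemma no_connected_matchings_imp_small:
  fixes G :: "'a pair_pre_digraph" and c :: "'a set \<Rightarrow> colour" and t :: "colour \<Rightarrow> nat"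
    and a :: "colour \<Rightarrow> real" and e m :: real
  assumes graph: "pair_graph G" and bip: "bipartition G V W"
    and no: "\<And>k H. \<not> connected_matching G c k (t k) H"
    and t: "\<And>k. real (t k) \<le> a k" and pos: "\<And>k. 0 < a k"
    and green: "a Red + a Blue \<le> a Green"
    and X0: "X0 \<subseteq> V" and Y0: "Y0 \<subseteq> W" and e: "0 \<le> e"
    and non: "\<And>y. y \<in> W \<Longrightarrow> card (non_neighbours G V y) \<le> e"
    and m: "\<And>k. 2 * (real (card X0) + card Y0) / a k + 1 \<le> m"
  shows "card X0 \<le> a Red + a Blue + a Green + 8 * m ^ 3 * e \<or> card Y0 \<le> a Red + a Blue + a Green"
proof (rule ccontr)
  assume neg: "\<not> ?thesis"
  interpret G: pair_graph G by fact
  have VW: "V \<union> W = pverts G" "V \<inter> W = {}" using bip unfolding bipartition_def by auto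
  have "finite V" "finite W" using VW(1) G.pair_finite_verts by (metis finite_Un)+
  then have fin: "finite X0" "finite Y0" using X0 Y0 finite_subset by blast+
  have disj: "X0 \<inter> Y0 = {}" using X0 Y0 VW by blast
  let ?V = "X0 \<union> Y0"
  have cardV: "real (card ?V) = card X0 + card Y0" using card_Un_disjoint[OF fin disj] by simp
  define covered :: "colour \<Rightarrow> ('a \<Rightarrow> 'a set) \<Rightarrow> 'a set \<Rightarrow> bool" where
    "covered = (\<lambda>k h S. finite S \<and> (\<forall>i. card {v\<in>S. h v = i} \<le> a k) \<and> card (h ` X0) \<le> m \<and>
      (\<forall>x\<in>X0. \<forall>y\<in>Y0. (x, y) \<in> parcs G \<longrightarrow> c {x, y} = k \<longrightarrow> h x = h y \<and> (x \<in> S \<or> y \<in> S)))"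
  have "\<forall>k. \<exists>h S. covered k h S"
  proof
    fix k
    obtain S and l :: "'a \<Rightarrow> 'a set" where S: "S \<subseteq> pverts G" "\<And>C. card {v\<in>S. l v = C} \<le> t k"
      and link: "\<And>x y. x \<in> V \<Longrightarrow> y \<in> W \<Longrightarrow> (x, y) \<in> parcs G \<Longrightarrow> c {x, y} = k \<Longrightarrow>
        l x = l y \<and> (x \<in> S \<or> y \<in> S)"
      by (rule component_cover[OF graph bip no[of k]], rule that) blast+
    \<comment> \<open>Only the part of the cover inside \<open>?V\<close> is kept, so that
      \<open>card ?V\<close> bounds the number of merged classes.\<close>
    have "card {v\<in>S \<inter> ?V. l v = C} \<le> a k" for C
    proof -
      have "finite S" using S(1) G.pair_finite_verts finite_subset by blast
      then have "card {v\<in>S \<inter> ?V. l v = C} \<le> card {v\<in>S. l v = C}" by (intro card_mono) auto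
      then show ?thesis using S(2)[of C] t[of k] by linarith
    qed
    then obtain \<pi> :: "'a set \<Rightarrow> 'a set" where \<pi>: "\<And>i. card {v\<in>S \<inter> ?V. \<pi> (l v) = i} \<le> a k"
      and few: "card ((\<lambda>v. \<pi> (l v)) ` ?V) \<le> 2 * card ?V / a k + 1"
      using merge_classes[of ?V "S \<inter> ?V" "a k" l] fin pos[of k] by auto
    have "card ((\<lambda>v. \<pi> (l v)) ` X0) \<le> card ((\<lambda>v. \<pi> (l v)) ` ?V)"
      using fin by (intro card_mono) auto
    then have "card ((\<lambda>v. \<pi> (l v)) ` X0) \<le> m" using few m[of k] cardV by simp
    moreover have "\<forall>x\<in>X0. \<forall>y\<in>Y0. (x, y) \<in> parcs G \<longrightarrow> c {x, y} = k \<longrightarrow>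
        \<pi> (l x) = \<pi> (l y) \<and> (x \<in> S \<inter> ?V \<or> y \<in> S \<inter> ?V)"
    proof (intro ballI impI)
      fix x y assume xy: "x \<in> X0" "y \<in> Y0" "(x, y) \<in> parcs G" "c {x, y} = k"
      show "\<pi> (l x) = \<pi> (l y) \<and> (x \<in> S \<inter> ?V \<or> y \<in> S \<inter> ?V)"
        using link[OF subsetD[OF X0 xy(1)] subsetD[OF Y0 xy(2)] xy(3,4)] xy(1,2) by simp
    qed
    moreover have "finite (S \<inter> ?V)" using fin by simp
    ultimately show "\<exists>h S. covered k h S" using \<pi> unfolding covered_def
      by (intro exI[of _ "\<lambda>v. \<pi> (l v)"] exI[of _ "S \<inter> ?V"] conjI allI)
  qed
  then have "\<exists>h. \<forall>k. \<exists>S. covered k (h k) S" by (rule choice)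
  then obtain h where "\<forall>k. \<exists>S. covered k (h k) S" by blast
  then have "\<exists>S. \<forall>k. covered k (h k) (S k)" by (rule choice)
  then obtain S where cov: "\<forall>k. covered k (h k) (S k)" by blast
  have S: "\<And>k. finite (S k)" "\<And>k i. card {v\<in>S k. h k v = i} \<le> a k" and few: "\<And>k. card (h k ` X0) \<le> m"
    using cov unfolding covered_def by blast+
  have link: "h k x = h k y \<and> (x \<in> S k \<or> y \<in> S k)"
    if "x \<in> X0" "y \<in> Y0" "(x, y) \<in> parcs G" "c {x, y} = k" for x y k
    using cov that unfolding covered_def by blast
  define \<tau> where "\<tau> = (\<lambda>v. ((h Red v, h Blue v, h Green v), v \<in> S Red, v \<in> S Blue, v \<in> S Green))"
  define X where "X = {x\<in>X0. e < card {x'\<in>X0. \<tau> x' = \<tau> x}}"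
  have "\<tau> ` X0 \<subseteq> (h Red ` X0 \<times> h Blue ` X0 \<times> h Green ` X0) \<times> (UNIV :: (bool \<times> bool \<times> bool) set)"
    unfolding \<tau>_def by auto
  then have "card (\<tau> ` X0) \<le> card ((h Red ` X0 \<times> h Blue ` X0 \<times> h Green ` X0) \<times> (UNIV :: (bool \<times> bool \<times> bool) set))"
    using fin by (intro card_mono) auto
  also have "\<dots> = card (h Red ` X0) * (card (h Blue ` X0) * card (h Green ` X0)) * 8"
    by (simp only: card_cartesian_product) (simp add: card_UNIV_bool flip: UNIV_Times_UNIV)
  finally have "real (card (\<tau> ` X0)) \<le> real (card (h Red ` X0) * (card (h Blue ` X0) * card (h Green ` X0)) * 8)"
    by (rule of_nat_mono)
  also have "\<dots> = real (card (h Red ` X0)) * (real (card (h Blue ` X0)) * real (card (h Green ` X0))) * 8"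
    by simp
  also have "\<dots> \<le> m * (m * m) * 8"
    using few by (intro mult_right_mono mult_mono) (auto intro: order_trans[OF of_nat_0_le_iff])
  finally have types: "card (\<tau> ` X0) \<le> 8 * m ^ 3" by (simp add: power3_eq_cube)
  have "real (card (X0 - X)) \<le> card (\<tau> ` X0) * e"
  proof -
    have "X0 - X = {x\<in>X0. card {x'\<in>X0. \<tau> x' = \<tau> x} \<le> e}" unfolding X_def by auto
    then show ?thesis using card_rare_types_le[OF fin(1) e, of \<tau>] by simp
  qed
  also have "\<dots> \<le> 8 * m ^ 3 * e" by (rule mult_right_mono[OF types e])
  finally have *: "real (card (X0 - X)) \<le> 8 * m ^ 3 * e" .
  have "real (card X0) \<le> card X + 8 * m ^ 3 * e"
  proof -
    have sub: "X \<subseteq> X0" unfolding X_def by blast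
    then have "finite X" using fin(1) finite_subset by blast
    then have "card (X \<union> (X0 - X)) = card X + card (X0 - X)"
      using fin(1) by (intro card_Un_disjoint) auto
    moreover have "X \<union> (X0 - X) = X0" using sub by blast
    ultimately show ?thesis using * by simp
  qed
  then have large: "a Red + a Blue + a Green < card X" "a Red + a Blue + a Green < card Y0"
    using neg by linarith+
  \<comment> \<open>More than \<open>e\<close> vertices of \<open>X0\<close> share the type of
    \<open>x\<close>, and \<open>y\<close> has at most \<open>e\<close> non-neighbours, so one of
    them is adjacent to \<open>y\<close>.\<close>
  have edge: "\<exists>x'. x' \<in> X0 \<and> \<tau> x' = \<tau> x \<and> (x', y) \<in> parcs G" if "x \<in> X" "y \<in> Y0" for x y
  proof (rule ccontr)
    assume none: "\<not> ?thesis"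
    have "{x'\<in>X0. \<tau> x' = \<tau> x} \<subseteq> non_neighbours G V y"
    proof
      fix x' assume x': "x' \<in> {x'\<in>X0. \<tau> x' = \<tau> x}"
      then have "(x', y) \<notin> parcs G" using none by simp
      then have "(y, x') \<notin> parcs G" using G.arcs_symmetric by blast
      then show "x' \<in> non_neighbours G V y" unfolding non_neighbours_def using x' X0 by auto
    qed
    moreover have "finite (non_neighbours G V y)" unfolding non_neighbours_def using \<open>finite V\<close> by simp
    ultimately have "card {x'\<in>X0. \<tau> x' = \<tau> x} \<le> card (non_neighbours G V y)" by (intro card_mono)
    moreover have "e < card {x'\<in>X0. \<tau> x' = \<tau> x}" using that(1) unfolding X_def by simp
    ultimately show False using non[of y] that(2) Y0 by (meson of_nat_mono order_trans not_le subsetD)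
  qed
  interpret two_cover "h Red" "S Red" "a Red" "h Blue" "S Blue" "a Blue"
    by unfold_locales (rule S)+
  interpret three_cover "h Red" "S Red" "a Red" "h Blue" "S Blue" "a Blue" "h Green" "S Green" "a Green" X Y0
  proof
    show "finite X" "X \<inter> Y0 = {}" using fin(1) disj unfolding X_def by (simp, blast)
    fix x y assume xy: "x \<in> X" "y \<in> Y0"
    then obtain x' where x': "x' \<in> X0" "\<tau> x' = \<tau> x" "(x', y) \<in> parcs G" using edge by blast
    have eq: "h k x' = h k x" "x' \<in> S k \<longleftrightarrow> x \<in> S k" for k
      using x'(2) unfolding \<tau>_def by (cases k; simp)+
    \<comment> \<open>The type records class and cover membership in every colour, so what this edge
      says about \<open>x'\<close> holds for \<open>x\<close> as well.\<close>
    define k where "k = c {x', y}"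
    have "h k x = h k y \<and> (x \<in> S k \<or> y \<in> S k)"
      using link[OF x'(1) xy(2) x'(3), of k] eq[of k] unfolding k_def by simp
    then show "joined {x} {y} \<or> h Green x = h Green y \<and> (x \<in> S Green \<or> y \<in> S Green)"
      unfolding joined_def by (cases k) auto
  qed (use S fin large green in auto)
  show False by (rule inconsistent)
qed

theorem theorem5p1:
  fixes \<alpha>\<^sub>1 \<alpha>\<^sub>2 \<alpha>\<^sub>3 \<beta> \<gamma> \<epsilon> :: real
  assumes "0 < \<alpha>\<^sub>1" and "\<alpha>\<^sub>1 < \<alpha>\<^sub>2" and "\<alpha>\<^sub>3 \<ge> \<alpha>\<^sub>1 + \<alpha>\<^sub>2"
    and "\<beta> = (2 * real_of_int \<lceil>(\<alpha>\<^sub>1 + \<alpha>\<^sub>2 + \<alpha>\<^sub>3 + 1) / \<alpha>\<^sub>1\<rceil>) ^ 6"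
    and "\<gamma> = 12 / \<alpha>\<^sub>1 * real_of_int \<lceil>(\<alpha>\<^sub>1 + \<alpha>\<^sub>2 + \<alpha>\<^sub>3 + 1) / \<alpha>\<^sub>1\<rceil>"
    and "0 < \<epsilon>" and "\<epsilon> < 1 / (\<beta> + (\<alpha>\<^sub>1 + \<alpha>\<^sub>2 + \<alpha>\<^sub>3) * \<gamma>)"
  shows "\<exists>n\<^sub>0::nat. \<forall>n>n\<^sub>0. \<forall>(G :: 'a pair_pre_digraph) V\<^sub>1 V\<^sub>2 (N::nat) (c :: 'a set \<Rightarrow> colour).
    pair_graph G \<and> bipartition G V\<^sub>1 V\<^sub>2 \<and> card V\<^sub>1 = N \<and> card V\<^sub>2 = N \<and>
    real N \<ge> (\<alpha>\<^sub>1 + \<alpha>\<^sub>2 + \<alpha>\<^sub>3 + (\<beta> + (\<alpha>\<^sub>1 + \<alpha>\<^sub>2 + \<alpha>\<^sub>3) * \<gamma>) * \<epsilon>) * real n \<and>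
    (\<forall>v\<in>V\<^sub>1. real (card (non_neighbours G V\<^sub>2 v)) \<le> \<epsilon> * real n) \<and>
    (\<forall>v\<in>V\<^sub>2. real (card (non_neighbours G V\<^sub>1 v)) \<le> \<epsilon> * real n)
    \<longrightarrow> (\<exists>H. connected_matching G c Red (nat \<lfloor>\<alpha>\<^sub>1 * real n\<rfloor>) H) \<or>
        (\<exists>H. connected_matching G c Blue (nat \<lfloor>\<alpha>\<^sub>2 * real n\<rfloor>) H) \<or>
        (\<exists>H. connected_matching G c Green (nat \<lfloor>\<alpha>\<^sub>3 * real n\<rfloor>) H)"
proof -
  define K where "K = real_of_int \<lceil>(\<alpha>\<^sub>1 + \<alpha>\<^sub>2 + \<alpha>\<^sub>3 + 1) / \<alpha>\<^sub>1\<rceil>"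
  define z where "z = \<alpha>\<^sub>1 + \<alpha>\<^sub>2 + \<alpha>\<^sub>3"
  define m where "m = z + (\<beta> + z * \<gamma>) * \<epsilon>"
  \<comment> \<open>Because \<open>z \<ge> 2 * (\<alpha>\<^sub>1 + \<alpha>\<^sub>2) > 4 *
    \<alpha>\<^sub>1\<close>, the ceiling is at least 5, as \<open>few_classes\<close>
    requires.\<close>
  have "4 < (z + 1) / \<alpha>\<^sub>1" using assms(1-3) unfolding z_def by (simp add: less_divide_eq)
  then have "4 < \<lceil>(z + 1) / \<alpha>\<^sub>1\<rceil>" by (simp add: less_ceiling_iff)
  then have K5: "5 \<le> K" unfolding K_def z_def by linarith
  have "(z + 1) / \<alpha>\<^sub>1 \<le> K" unfolding K_def z_def by (rule le_of_int_ceiling)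
  then have zK: "z + 1 \<le> K * \<alpha>\<^sub>1" by (simp only: pos_divide_le_eq[OF assms(1)])
  have z0: "0 < z" using assms(1-3) unfolding z_def by linarith
  have \<gamma>: "0 < \<gamma>" using assms(1,5) K5 unfolding K_def by simp
  have \<beta>: "\<beta> = 64 * K ^ 6" using assms(4) unfolding K_def by (simp add: power_mult_distrib)
  have K3: "125 \<le> K ^ 3" using power_mono[OF K5, of 3] by simp
  \<comment> \<open>With at most \<open>5 * K\<close> classes of each colour there are at most
    \<open>8 * (5 * K) ^ 3\<close> types; the aim is that \<open>\<beta>\<close> is at least this
    number.\<close>
  have "125 * K ^ 3 \<le> K ^ 3 * K ^ 3" using K3 K5 by (intro mult_right_mono) simp_all
  then have "8 * (125 * K ^ 3) \<le> 64 * K ^ 6" using K3 by (simp flip: power_add)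
  then have \<beta>K: "8 * (5 * K) ^ 3 \<le> \<beta>" unfolding \<beta> by (simp add: power_mult_distrib)
  have pos: "0 < \<beta> + z * \<gamma>" using \<beta>K K3 z0 \<gamma> by (simp add: power_mult_distrib add_pos_pos)
  then have "(\<beta> + z * \<gamma>) * \<epsilon> \<le> 1"
    using assms(7) unfolding z_def by (simp add: less_divide_eq mult.commute)
  moreover have "0 < (\<beta> + z * \<gamma>) * \<epsilon>" using pos assms(6) by simp
  ultimately have m: "z \<le> m" "m \<le> z + 1" unfolding m_def by simp_all
  show ?thesis
  proof (intro exI[of _ "nat \<lceil>1 / \<alpha>\<^sub>1\<rceil>"] allI impI, elim conjE)
    fix n :: nat and G :: "'a pair_pre_digraph" and V W N and c :: "'a set \<Rightarrow> colour"
    assume n: "nat \<lceil>1 / \<alpha>\<^sub>1\<rceil> < n" and G: "pair_graph G" "bipartition G V W" and N: "card V = N" "card W = N"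
      and large: "(\<alpha>\<^sub>1 + \<alpha>\<^sub>2 + \<alpha>\<^sub>3 + (\<beta> + (\<alpha>\<^sub>1 + \<alpha>\<^sub>2 + \<alpha>\<^sub>3) * \<gamma>) * \<epsilon>) * real n \<le> real N"
      and non: "\<forall>v\<in>W. real (card (non_neighbours G V v)) \<le> \<epsilon> * real n"
    have "1 / \<alpha>\<^sub>1 < n" using n by linarith
    then have n1: "1 \<le> \<alpha>\<^sub>1 * n" using assms(1) by (simp add: divide_less_eq mult.commute)
    have n0: "0 < real n" using n by simp
    \<comment> \<open>The bound on the number of merged classes grows with the sides, which may be
      arbitrarily large, so subsets with exactly this many vertices replace them.\<close>
    define N0 where "N0 = nat \<lceil>m * n\<rceil>"
    have mn: "0 \<le> m * n" using m(1) z0 by simp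
    have N0: "m * n \<le> N0" "N0 \<le> m * n + 1" unfolding N0_def using mn by linarith+
    have "N0 \<le> N" using large unfolding N0_def m_def z_def by linarith
    then obtain X0 Y0 where X0: "X0 \<subseteq> V" "card X0 = N0" and Y0: "Y0 \<subseteq> W" "card Y0 = N0"
      using obtain_subset_with_card_n N by metis
    define a where "a = (\<lambda>k. (case k of Red \<Rightarrow> \<alpha>\<^sub>1 | Blue \<Rightarrow> \<alpha>\<^sub>2 | Green \<Rightarrow> \<alpha>\<^sub>3) * real n)"
    have few: "2 * (real (card X0) + card Y0) / a k + 1 \<le> 5 * K" for k
    proof -
      have "2 * (2 * real N0) / (b * n) + 1 \<le> 5 * K" if "\<alpha>\<^sub>1 \<le> b" for b
        by (rule few_classes[OF n1 zK assms(1) n0 K5 N0(2) m(2) that])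
      then show ?thesis
        using assms(1-3) unfolding X0 Y0 a_def by (cases k) auto
    qed
    \<comment> \<open>The term with \<open>\<beta>\<close> in \<open>m * n\<close> pays for the
      vertices of rare type, and the positive term with \<open>\<gamma>\<close> makes the inequality
      strict.\<close>
    have small: "8 * (5 * K) ^ 3 * (\<epsilon> * n) + z * n < N0"
    proof -
      have "8 * (5 * K) ^ 3 * (\<epsilon> * n) \<le> \<beta> * (\<epsilon> * n)"
        using \<beta>K assms(6) by (intro mult_right_mono) auto
      also have "\<dots> < (\<beta> + z * \<gamma>) * (\<epsilon> * n)"
        using z0 \<gamma> assms(6) n0 by (intro mult_strict_right_mono) auto
      finally have "8 * (5 * K) ^ 3 * (\<epsilon> * n) + z * n < m * n"
        unfolding m_def by (simp add: algebra_simps)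
      then show ?thesis using N0(1) by linarith
    qed
    have sum: "a Red + a Blue + a Green = z * n" unfolding a_def z_def by (simp add: algebra_simps)
    show "(\<exists>H. connected_matching G c Red (nat \<lfloor>\<alpha>\<^sub>1 * real n\<rfloor>) H) \<or>
        (\<exists>H. connected_matching G c Blue (nat \<lfloor>\<alpha>\<^sub>2 * real n\<rfloor>) H) \<or>
        (\<exists>H. connected_matching G c Green (nat \<lfloor>\<alpha>\<^sub>3 * real n\<rfloor>) H)"
    proof (rule ccontr)
      assume neg: "\<not> ?thesis"
      have apos: "0 < a k" for k using assms(1-3) n0 unfolding a_def by (cases k) auto
      have "card X0 \<le> a Red + a Blue + a Green + 8 * (5 * K) ^ 3 * (\<epsilon> * n) \<or>
          card Y0 \<le> a Red + a Blue + a Green"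
      proof (rule no_connected_matchings_imp_small[OF G _ _ apos _ X0(1) Y0(1) _ _ few])
        show "\<not> connected_matching G c k (nat \<lfloor>a k\<rfloor>) H" for k H
          using neg unfolding a_def by (cases k) auto
        show "real (nat \<lfloor>a k\<rfloor>) \<le> a k" for k using apos[of k] by linarith
        show "a Red + a Blue \<le> a Green"
          using assms(3) n0 unfolding a_def by (simp flip: distrib_right)
        show "0 \<le> \<epsilon> * real n" using assms(6) by simp
      qed (use non in auto)
      moreover have "0 \<le> 8 * (5 * K) ^ 3 * (\<epsilon> * n)" using K5 assms(6) by simp
      ultimately show False using small unfolding X0 Y0 sum by linarith
    qed
  qed
qed

end
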